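(* Let $1\le m\le N$ and put $g=\min\{\Delta_m-\Delta_{m-1},\Delta_{m+1}-\Delta_m\}$. Let the player use the DSEE (Deterministic Sequencing of Exploration and Exploitation) policy $\pi$ in which, in the exploitation sequence, the player selects the arm with the $m$-th largest sample mean (truncated sample mean in (iv)). Then the following hold. (i) Suppose all reward distributions are light-tailed. Let $\zeta,u_0>0$ and $a\in(0,\frac1{2\zeta}]$ be constants such that for every arm $n$, every $s\ge1$ and every $\delta'\in[0,\zeta u_0]$, $\Pr(|\frac1s\sum_{t=1}^sX_n(t)-\theta_n|\ge\delta')\le2\exp(-a\delta'^2s)$. Choose a constant $c$ with $0<c<g$, $\delta=\min\{c/2,\zeta u_0\}$, and a constant $w>\frac1{a\delta^2}$. For each $t>1$, include $t$ in the exploration sequence if $|\mathcal A(t-1)|<N\lceil w\log t\rceil$. Then for all $T$, $$R_T^\pi(\mathcal F,m)\le\sum_{n=2}^N\lceil w\log T\rceil\Delta_n+2N\Delta_N\left(1+\frac1{a\delta^2w-1}\right).$$ (ii) Suppose all reward distributions are light-tailed. Let $f(t)$ be any positive increasing sequence with $f(t)\to\infty$ as $t\to\infty$. For each $t>1$, include $t$ in the exploration sequence if $|\mathcal A(t-1)|<N\lceil f(t)\log t\rceil$. Then $R_T^\pi(\mathcal F,m)=O(f(T)\log T)$. (iii) Suppose the reward distributions have finite $p$th order moment for some $p>1$. Choose a constant $v>0$, and let the deviation parameter $\delta$ (the level in the event that all sample means are within $\delta$ of the true means; it does not enter the policy) satisfy $0<\delta<\frac12g$. For each $t>1$, include $t$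 in the exploration sequence if $|\mathcal A(t-1)|<vt^{1/p}$ (when $1<p\le2$), respectively $|\mathcal A(t-1)|<vt^{1/(1+p/2)}$ (when $p>2$). Then $R_T^\pi(\mathcal F,m)\le O(T^{1/p})$ if $1<p\le2$ and $R_T^\pi(\mathcal F,m)\le O(T^{1/(1+p/2)})$ if $p>2$. (iv) Suppose $\mathbb E[|X_n(1)|^p]\le u$ for every arm $n$, for some constants $u>0$ and $p\in(1,2]$. Let $a=4^{\frac p{1-p}}u^{\frac1{1-p}}$, choose a constant $\delta$ with $0<\delta<\frac12g$ and a constant $w>\frac1{a\delta^{p/(p-1)}}$. For each $t>1$, include $t$ in the exploration sequence if $|\mathcal A(t-1)|<N\lceil w\log t\rceil$. Let arms be ranked in the exploitation sequence by the truncated sample mean with parameters $u,p,a,\delta$. Then for all $T$, $$R_T^\pi(\mathcal F,m)\le\sum_{n=2}^N\lceil w\log T\rceil\Delta_n+2N\Delta_N\left(1+\frac1{a\delta^{p/(p-1)}w-1}\right).$$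
   Context: Bandit model: there are $N\ge2$ independent arms and a single player, who plays one arm at each time. Playing arm $n$ at time $t\in\{1,2,\dots\}$ yields a reward $X_n(t)$; for each $n$ the rewards are i.i.d. over time with unknown distribution $f_n$ and finite mean $\theta_n$. $\mathcal F=(f_1,\dots,f_N)$. Let $\sigma$ be a permutation of $\{1,\dots,N\}$ with $\theta_{\sigma(1)}\ge\cdots\ge\theta_{\sigma(N)}$, and $\Delta_n=\theta_{\sigma(1)}-\theta_{\sigma(n)}$ (so $\Delta_1=0$), with the conventions $\Delta_0=-\infty$, $\Delta_{N+1}=+\infty$ (a gap to a non-existent arm is dropped from the minimum). The $j$th best arm is $\sigma(j)$. A random variable $X$ is light-tailed if for some $u_0>0$, $\mathbb E[\exp(uX)]<\infty$ for all $|u|\le u_0$. $\log$ is the natural logarithm. Asymptotic orders are as $T\to\infty$. Objective: the desired arm is the $m$th best arm. A cost $C_j>0$ ($j\ne m$, $1\le j\le N$) is incurred when the player plays the $j$th best arm. The regret $R_T^\pi(\mathcal F,m)$ is the expected total cost over time $T$ under policy $\pi$. DSEE policy: time is divided into an exploration sequence and an exploitation sequence. $\mathcal A(t)$ is the deterministic set of exploration times up to and including $t$, $|\mathcal A(t)|$ its cardinality, $\mathcal A(1)=\emptyset$; a time not included by the stated rule is an exploitation time. With $k\oslash l=((k-1)\bmod l)+1$, at an exploration time $t$ the player plays arm $|\mathcal A(t)|\oslash N$. At an exploitation time $t$ the player plays the arm with the $m$-th largest sample mean, where the sample mean of each arm is computed from the reward observations at times in $\mathcal A(t-1)$. Truncated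 sample mean (used in (iv)): if $X_{n,k}$ is the $k$th observation of arm $n$ during the exploration sequence and $\tau_n(t)$ the total number of such observations at time $t$, it is $\frac1{\tau_n(t)}\sum_{k=1}^{\tau_n(t)}X_{n,k}\mathbf 1\{|X_{n,k}|\le(\frac{uk}{\log(\epsilon_n(t)^{-1})})^{1/p}\}$ with $\epsilon_n(t)=\exp(-a\delta^{p/(p-1)}\tau_n(t))$.
   Formalization: In (i) and (iv) the displayed bound is proved when the sum of the costs C_j is at most the sum of the gaps and max C_j ≤ Δ_N; for arbitrary costs it is proved with C_j in place of the gaps and max C_j in place of Δ_N. Part (ii) assumes g>0. *)

theory Defs
  imports "HOL-Probability.Probability" "HOL-Library.Landau_Symbols" "HOL-Combinatorics.Permutations"
begin

section \<open>Bandit model\<close>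

text \<open>\<open>X n t\<close> is the reward that arm \<open>n\<close> would yield at time \<open>t\<close>. Only indices \<open>1 \<le> n \<le> N\<close> and
  \<open>1 \<le> t\<close> are meaningful. Independence is joint over arms and times.\<close>

locale stochastic_bandit = prob_space M
  for M :: "'a measure" +
  fixes N :: nat and X :: "nat \<Rightarrow> nat \<Rightarrow> 'a \<Rightarrow> real" and F :: "nat \<Rightarrow> real measure"
  assumes two_arms: "2 \<le> N"
    and indep_rewards: "indep_vars (\<lambda>_. borel) (\<lambda>(n, t). X n t) ({1..N} \<times> {1..})"
    and reward_distr: "\<And>n t. n \<in> {1..N} \<Longrightarrow> 1 \<le> t \<Longrightarrow> distr M borel (X n t) = F n"
    and finite_mean: "\<And>n. n \<in> {1..N} \<Longrightarrow> integrable (F n) (\<lambda>x. x)"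

definition arm_mean :: "(nat \<Rightarrow> real measure) \<Rightarrow> nat \<Rightarrow> real" where
  "arm_mean F n = (\<integral>x. x \<partial>F n)"

definition light_tailed :: "real measure \<Rightarrow> bool" where
  "light_tailed D \<longleftrightarrow> (\<exists>u0>0. \<forall>u. \<bar>u\<bar> \<le> u0 \<longrightarrow> integrable D (\<lambda>x. exp (u * x)))"

definition ranks_arms :: "nat \<Rightarrow> (nat \<Rightarrow> real) \<Rightarrow> (nat \<Rightarrow> nat) \<Rightarrow> bool" where
  "ranks_arms N x \<rho> \<longleftrightarrow>
     \<rho> permutes {1..N} \<and> (\<forall>i\<in>{1..N}. \<forall>j\<in>{1..N}. i \<le> j \<longrightarrow> x (\<rho> j) \<le> x (\<rho> i))"

definition gap :: "(nat \<Rightarrow> real measure) \<Rightarrow> (nat \<Rightarrow> nat) \<Rightarrow> nat \<Rightarrow> real" where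
  "gap F \<sigma> n = arm_mean F (\<sigma> 1) - arm_mean F (\<sigma> n)"

text \<open>The minimum of \<open>gap m - gap (m - 1)\<close> and \<open>gap (m + 1) - gap m\<close>; intersecting with \<open>{2..N}\<close>
  drops a difference that involves the non-existent rank \<open>0\<close> or \<open>N + 1\<close>. At least one difference
  remains when \<open>1 \<le> m \<le> N\<close> and \<open>2 \<le> N\<close>.\<close>

definition separation :: "nat \<Rightarrow> (nat \<Rightarrow> real measure) \<Rightarrow> (nat \<Rightarrow> nat) \<Rightarrow> nat \<Rightarrow> real" where
  "separation N F \<sigma> m = Min ((\<lambda>j. gap F \<sigma> j - gap F \<sigma> (j - 1)) ` ({m, m + 1} \<inter> {2..N}))"

section \<open>Deterministic sequencing of exploration and exploitation\<close>

text \<open>\<open>explored B t\<close> is the set of exploration times up to and including \<open>t\<close> when a time \<open>t > 1\<close> is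
  included iff fewer than \<open>B t\<close> times have been included before. Thus \<open>t\<close> is an exploration time
  iff \<open>t \<in> explored B t\<close>.\<close>

fun explored :: "(nat \<Rightarrow> real) \<Rightarrow> nat \<Rightarrow> nat set" where
  "explored B 0 = {}"
| "explored B (Suc t) =
     (if 1 < Suc t \<and> real (card (explored B t)) < B (Suc t)
      then insert (Suc t) (explored B t) else explored B t)"

definition round_robin :: "nat \<Rightarrow> nat \<Rightarrow> nat" where
  "round_robin k l = (k - 1) mod l + 1"

definition obs_times :: "nat \<Rightarrow> (nat \<Rightarrow> real) \<Rightarrow> nat \<Rightarrow> nat \<Rightarrow> nat set" where
  "obs_times N B n t = {s \<in> explored B t. round_robin (card (explored B s)) N = n}"

text \<open>For the two statistics below, only observations strictly before \<open>t\<close> are used. With no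
  observation yet, both are \<open>0\<close> by the convention on division by zero.\<close>

definition sample_mean ::
  "(nat \<Rightarrow> nat \<Rightarrow> 'a \<Rightarrow> real) \<Rightarrow> nat \<Rightarrow> (nat \<Rightarrow> real) \<Rightarrow> nat \<Rightarrow> nat \<Rightarrow> 'a \<Rightarrow> real" where
  "sample_mean X N B n t \<omega> =
     (\<Sum>s\<in>obs_times N B n (t - 1). X n s \<omega>) / real (card (obs_times N B n (t - 1)))"

definition observation ::
  "(nat \<Rightarrow> nat \<Rightarrow> 'a \<Rightarrow> real) \<Rightarrow> nat \<Rightarrow> (nat \<Rightarrow> real) \<Rightarrow> nat \<Rightarrow> nat \<Rightarrow> nat \<Rightarrow> 'a \<Rightarrow> real" where
  "observation X N B n t k \<omega> = X n (sorted_list_of_set (obs_times N B n (t - 1)) ! (k - 1)) \<omega>"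

definition truncated_mean ::
  "real \<Rightarrow> real \<Rightarrow> real \<Rightarrow> real \<Rightarrow>
   (nat \<Rightarrow> nat \<Rightarrow> 'a \<Rightarrow> real) \<Rightarrow> nat \<Rightarrow> (nat \<Rightarrow> real) \<Rightarrow> nat \<Rightarrow> nat \<Rightarrow> 'a \<Rightarrow> real" where
  "truncated_mean u p a \<delta> X N B n t \<omega> =
     (let \<tau> = card (obs_times N B n (t - 1));
          \<epsilon> = exp (- a * \<delta> powr (p / (p - 1)) * real \<tau>)
      in (\<Sum>k=1..\<tau>. if \<bar>observation X N B n t k \<omega>\<bar> \<le> (u * real k / ln (inverse \<epsilon>)) powr (1 / p)
                     then observation X N B n t k \<omega> else 0) / real \<tau>)"

text \<open>\<open>\<pi> t \<omega>\<close> is the arm played at time \<open>t\<close>, and \<open>S n t\<close> is the statistic by which arms are ranked at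
  an exploitation time. The arm in position \<open>m\<close> of some decreasing ordering of the statistics is
  played; how ties are broken is left completely open (possibly depending on \<open>t\<close>, on the past
  or on extra randomness), subject only to measurability.\<close>

definition dsee_policy ::
  "'a measure \<Rightarrow> nat \<Rightarrow> (nat \<Rightarrow> real) \<Rightarrow> nat \<Rightarrow> (nat \<Rightarrow> nat \<Rightarrow> 'a \<Rightarrow> real) \<Rightarrow> (nat \<Rightarrow> 'a \<Rightarrow> nat) \<Rightarrow> bool"
where
  "dsee_policy M N B m S \<pi> \<longleftrightarrow>
     (\<forall>t\<ge>1. \<pi> t \<in> measurable M (count_space UNIV) \<and>
       (\<forall>\<omega>\<in>space M.
          if t \<in> explored B t then \<pi> t \<omega> = round_robin (card (explored B t)) N
          else \<exists>\<rho>. ranks_arms N (\<lambda>n. S n t \<omega>) \<rho> \<and> \<pi> t \<omega> = \<rho> m))"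

section \<open>Regret\<close>

text \<open>\<open>C j\<close> is the cost of playing the \<open>j\<close>th best arm \<open>\<sigma> j\<close>; the desired arm \<open>\<sigma> m\<close> is free.\<close>

definition regret ::
  "'a measure \<Rightarrow> nat \<Rightarrow> (nat \<Rightarrow> nat) \<Rightarrow> (nat \<Rightarrow> real) \<Rightarrow> nat \<Rightarrow> (nat \<Rightarrow> 'a \<Rightarrow> nat) \<Rightarrow> nat \<Rightarrow> real" where
  "regret M N \<sigma> C m \<pi> T =
     (\<integral>\<omega>. (\<Sum>t=1..T. \<Sum>j\<in>{1..N} - {m}. if \<pi> t \<omega> = \<sigma> j then C j else 0) \<partial>M)"

end

theory Submission
  imports Defs
begin

text \<open>Exploration times are distributed evenly over the arms, so an arm is explored at most as often as
  its share of the budget allows, and at an exploitation time every arm has been observed at least that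
  often. If all statistics are within \<open>d\<close> of the means, where \<open>2 * d\<close> is below the separation of rank
  \<open>m\<close>, then every decreasing ordering of them has the desired arm in position \<open>m\<close>. Hence the regret is
  at most the exploration cost plus the largest cost times the summed deviation probabilities at the
  exploitation times. These come from the assumed tail bound in (i), from Chernoff's bound in (ii),
  from a moment inequality \<open>E \<bar>S\<^sub>k\<bar>\<^sup>p = O(k\<^sup>\<kappa>)\<close> with \<open>\<kappa> = max 1 (p / 2)\<close> for centered sums of \<open>k\<close>
  rewards in (iii), and in (iv) from Chernoff's bound for the truncated rewards together with a bound on
  the truncation bias. The budgets make the summed probabilities bounded in (i), (ii), (iv) and of the
  same order as the budget in (iii).\<close>

section \<open>Elementary inequalities\<close>

text \<open>Determinism of the exploration is what keeps the probability simple: at each time the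
  observations of an arm are rewards at a fixed finite set of times, so they are independent and
  their number is a constant. No conditioning on the past and no union over possible sample sizes
  occurs, however the exploitation times are played. The exponents in (iii) come from balancing.
  With \<open>\<beta> = p - \<kappa>\<close> Markov's inequality bounds the deviation probability of
  a mean of \<open>k\<close> rewards by a multiple of \<open>k powr - \<beta>\<close>. For a budget
  of order \<open>t powr q\<close> the sum up to \<open>T\<close> is then of order
  \<open>T powr (1 - q * \<beta>)\<close>, which matches the budget exactly if
  \<open>q = 1 / (1 + \<beta>)\<close>: this is \<open>1 / p\<close> for \<open>p \<le> 2\<close>
  and \<open>1 / (1 + p / 2)\<close> otherwise. Costs are arbitrary positive numbers. Scaling them
  scales the regret but not the gaps, so a bound by gaps needs a comparison of the two. The proof
  therefore works with \<open>C\<close> throughout and passes to gaps at the end, under two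
  inequalities that are equalities for \<open>m = 1\<close> and costs equal to gaps.\<close>

lemma sum_powr_le:
  fixes q :: real
  assumes "0 < q" "q \<le> 1"
  shows "(\<Sum>k=1..n. real k powr (q - 1)) \<le> real n powr q / q"
proof (induction n)
  case (Suc n)
  have "q * (real n + 1) powr (q - 1) \<le> (real n + 1) powr q - real n powr q"
  \<comment> \<open>The power with exponent \<open>q\<close> need not be differentiable at 0, so the
    mean value theorem is applied only away from 0.\<close>
  proof (cases "n = 0")
    case False
    have "\<exists>z>real n. z < real n + 1 \<and>
        (real n + 1) powr q - real n powr q = (real n + 1 - real n) * (q * z powr (q - 1))"
      using False by (intro MVT2) (auto intro!: derivative_eq_intros)
    then obtain z where z: "real n < z" "z < real n + 1"
      "(real n + 1) powr q - real n powr q = q * z powr (q - 1)"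
      by auto
    have "(real n + 1) powr (q - 1) \<le> z powr (q - 1)"
      using z False assms by (intro powr_mono2') auto
    with z(3) assms show ?thesis by simp
  qed (use assms in auto)
  with Suc.IH assms show ?case
    by (simp add: field_simps)
qed simp

lemma sum_powr_minus_le:
  fixes \<alpha> :: real
  assumes "1 < \<alpha>"
  shows "(\<Sum>k=2..n. real k powr - \<alpha>) \<le> 1 / (\<alpha> - 1)"
proof -
  \<comment> \<open>The induction needs the exact integral of the power from 1 to
    \<open>n + 1\<close>; the constant bound alone would not be inductive.\<close>
  have "(\<Sum>k=2..Suc n. real k powr - \<alpha>) \<le> (1 - (real n + 1) powr (1 - \<alpha>)) / (\<alpha> - 1)" for n
  proof (induction n)
    case (Suc n)
    have "\<exists>z>real n + 1. z < real n + 2 \<and>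
        (real n + 2) powr (1 - \<alpha>) - (real n + 1) powr (1 - \<alpha>)
          = (real n + 2 - (real n + 1)) * ((1 - \<alpha>) * z powr (1 - \<alpha> - 1))"
      by (intro MVT2) (auto intro!: derivative_eq_intros)
    then obtain z where z: "real n + 1 < z" "z < real n + 2"
      "(real n + 2) powr (1 - \<alpha>) - (real n + 1) powr (1 - \<alpha>) = (1 - \<alpha>) * z powr - \<alpha>"
      by auto
    have "(real n + 2) powr - \<alpha> \<le> z powr - \<alpha>"
      using z assms by (intro powr_mono2') auto
    hence "(\<alpha> - 1) * (real n + 2) powr - \<alpha> \<le> (\<alpha> - 1) * z powr - \<alpha>"
      using assms by (intro mult_left_mono) auto
    hence "(\<alpha> - 1) * (real n + 2) powr - \<alpha> \<le> (real n + 1) powr (1 - \<alpha>) - (real n + 2) powr (1 - \<alpha>)"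
      using z(3) by (simp add: algebra_simps)
    hence "(real n + 2) powr - \<alpha> \<le> ((real n + 1) powr (1 - \<alpha>) - (real n + 2) powr (1 - \<alpha>)) / (\<alpha> - 1)"
      using assms by (simp add: field_simps)
    with Suc.IH show ?case
      by (simp add: diff_divide_distrib add.commute)
  qed simp
  moreover have "(\<Sum>k=2..n. real k powr - \<alpha>) \<le> (\<Sum>k=2..Suc n. real k powr - \<alpha>)"
    by (rule sum_mono2) auto
  moreover have "(1 - (real n + 1) powr (1 - \<alpha>)) / (\<alpha> - 1) \<le> 1 / (\<alpha> - 1)"
    using assms by (intro divide_right_mono) auto
  ultimately show ?thesis
    by (meson order_trans)
qed

section \<open>Quadratic bounds for the exponential function\<close>

lemma exp_le_quadratic:
  fixes x :: real
  assumes "x \<le> 1"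
  shows "exp x \<le> 1 + x + x\<^sup>2"
proof (cases "0 \<le> x")
  case False
  have "1 * 1 \<le> exp (- x) * (1 + x + x\<^sup>2)"
  proof -
    \<comment> \<open>The product on the right is 1 minus the cube of \<open>x\<close>, and
      \<open>x\<close> is negative here.\<close>
    have "1 * 1 \<le> (1 - x) * (1 + x + x\<^sup>2)"
      using False mult_nonneg_nonneg[of "- x" "x * x"]
      by (simp add: algebra_simps power2_eq_square)
    also have "\<dots> \<le> exp (- x) * (1 + x + x\<^sup>2)"
    proof (intro mult_right_mono)
      show "1 - x \<le> exp (- x)"
        using exp_ge_add_one_self[of "- x"] by simp
      have "1 + x + x\<^sup>2 = (1 + x / 2)\<^sup>2 + 3 / 4 * x\<^sup>2"
        by (simp add: power2_eq_square algebra_simps)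
      thus "0 \<le> 1 + x + x\<^sup>2" by simp
    qed
    finally show ?thesis .
  qed
  thus ?thesis by (simp add: exp_minus field_simps)
qed (use assms exp_bound in auto)

text \<open>Up to 1 the additional factor is at least 1; beyond 1 the last term alone exceeds
  \<open>exp x\<close>. Having no restriction on \<open>x\<close>, the bound can serve unbounded
  rewards.\<close>

lemma exp_le_quadratic_abs:
  fixes x :: real
  shows "exp x \<le> 1 + x + x\<^sup>2 * exp \<bar>x\<bar>"
proof (cases "x \<le> 1")
  case True
  have "x\<^sup>2 * 1 \<le> x\<^sup>2 * exp \<bar>x\<bar>" by (intro mult_left_mono) auto
  with exp_le_quadratic[OF True] show ?thesis by simp
next
  case False
  have "1 * exp x \<le> x\<^sup>2 * exp x"
    using False by (intro mult_right_mono) (auto simp: one_le_power)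
  hence "exp x \<le> x\<^sup>2 * exp \<bar>x\<bar>" using False by simp
  thus ?thesis using False by linarith
qed

text \<open>A second order expansion of \<open>\<bar>x + y\<bar> powr p\<close> whose remainder is split by Young's inequality with
  a free scale \<open>r\<close>. The linear term vanishes in expectation if \<open>y\<close> is centered and independent of \<open>x\<close>,
  so taking \<open>r\<close> proportional to the number of summands makes the moment bound below inductive.\<close>

lemma abs_add_powr_le:
  fixes p :: real
  assumes "1 < p"
  shows "\<exists>C\<ge>1. \<forall>x y r :: real. 1 \<le> r \<longrightarrow>
    \<bar>x + y\<bar> powr p \<le> \<bar>x\<bar> powr p + p * y * (sgn x * \<bar>x\<bar> powr (p - 1)) +
      C * (1 + \<bar>y\<bar> powr p) * (\<bar>x\<bar> powr p / r + r powr (max 1 (p / 2) - 1))"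
proof (intro exI conjI allI impI)
  \<comment> \<open>\<open>C1\<close> serves the case where \<open>y\<close> is comparable to
    \<open>x\<close>: its first summand bounds the left side, its second compensates a negative
    linear term. \<open>C2\<close> bounds the second order term of \<open>(1 + z) powr p\<close>,
    where the exponent \<open>\<bar>p * z\<bar>\<close> is at most \<open>p\<close>.\<close>
  define C1 where "C1 = 3 powr p + p * 2 powr (p - 1)"
  define C2 where "C2 = p\<^sup>2 * exp p"
  have C1: "0 \<le> C1" using assms by (simp add: C1_def)
  have C2: "0 \<le> C2" by (simp add: C2_def)
  show "1 \<le> 1 + C1 + C2" using C1 C2 by simp
  fix x y r :: real
  assume r: "1 \<le> r"
  define A where "A = \<bar>x\<bar> powr p / r + r powr (max 1 (p / 2) - 1)"
  have r': "1 \<le> r powr (max 1 (p / 2) - 1)"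
    using r by (intro ge_one_powr_ge_zero) auto
  have A: "1 \<le> A" using r r' by (auto simp: A_def intro: add_increasing)
  show "\<bar>x + y\<bar> powr p \<le> \<bar>x\<bar> powr p + p * y * (sgn x * \<bar>x\<bar> powr (p - 1)) +
      (1 + C1 + C2) * (1 + \<bar>y\<bar> powr p) * (\<bar>x\<bar> powr p / r + r powr (max 1 (p / 2) - 1))"
  proof (cases "\<bar>x\<bar> \<le> 2 * \<bar>y\<bar>")
    case True
    have "\<bar>x + y\<bar> powr p \<le> (3 * \<bar>y\<bar>) powr p"
      using True assms by (intro powr_mono2) auto
    hence 1: "\<bar>x + y\<bar> powr p \<le> 3 powr p * \<bar>y\<bar> powr p" by (simp add: powr_mult)
    have "\<bar>x\<bar> powr (p - 1) \<le> (2 * \<bar>y\<bar>) powr (p - 1)"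
      using True assms by (intro powr_mono2) auto
    also have "\<dots> = 2 powr (p - 1) * \<bar>y\<bar> powr (p - 1)" by (simp add: powr_mult)
    finally have "\<bar>y\<bar> * \<bar>x\<bar> powr (p - 1) \<le> \<bar>y\<bar> * (2 powr (p - 1) * \<bar>y\<bar> powr (p - 1))"
      by (intro mult_left_mono) auto
    also have "\<dots> = 2 powr (p - 1) * (\<bar>y\<bar> * \<bar>y\<bar> powr (p - 1))" by simp
    also have "\<bar>y\<bar> * \<bar>y\<bar> powr (p - 1) = \<bar>y\<bar> powr p" by (simp add: powr_mult_base)
    finally have 2: "\<bar>y\<bar> * \<bar>x\<bar> powr (p - 1) \<le> 2 powr (p - 1) * \<bar>y\<bar> powr p" .
    have "- (p * y * (sgn x * \<bar>x\<bar> powr (p - 1))) \<le> \<bar>p * y * (sgn x * \<bar>x\<bar> powr (p - 1))\<bar>"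
      by simp
    also have "\<dots> \<le> p * (\<bar>y\<bar> * \<bar>x\<bar> powr (p - 1))"
      using assms by (auto simp: abs_mult sgn_if)
    also have "\<dots> \<le> p * (2 powr (p - 1) * \<bar>y\<bar> powr p)"
      using 2 assms by (intro mult_left_mono) auto
    finally have "\<bar>x + y\<bar> powr p \<le> p * y * (sgn x * \<bar>x\<bar> powr (p - 1)) + C1 * \<bar>y\<bar> powr p"
      using 1 by (simp add: C1_def algebra_simps)
    moreover have "C1 * \<bar>y\<bar> powr p * 1 \<le> (1 + C1 + C2) * (1 + \<bar>y\<bar> powr p) * A"
      using C1 C2 A by (intro mult_mono) auto
    moreover have "0 \<le> \<bar>x\<bar> powr p" by simp
    ultimately show ?thesis unfolding A_def by linarith
  next
    case False
    define z where "z = y / x"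
    have x: "x \<noteq> 0" and z: "\<bar>z\<bar> \<le> 1 / 2" using False by (auto simp: z_def field_simps)
    have "\<bar>x + y\<bar> = \<bar>x\<bar> * (1 + z)"
    proof -
      have "x + y = x * (1 + z)" using x by (simp add: z_def field_simps)
      thus ?thesis using z by (simp add: abs_mult)
    qed
    hence "\<bar>x + y\<bar> powr p = \<bar>x\<bar> powr p * (1 + z) powr p"
      using z by (simp add: powr_mult)
    also have "(1 + z) powr p \<le> 1 + p * z + C2 * z\<^sup>2"
    proof -
      have "ln (1 + z) \<le> z" using z by (intro ln_add_one_self_le_self2) auto
      hence "(1 + z) powr p \<le> exp (p * z)"
        using z assms by (auto simp: powr_def)
      also have "\<dots> \<le> 1 + p * z + (p * z)\<^sup>2 * exp \<bar>p * z\<bar>"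
        by (rule exp_le_quadratic_abs)
      also have "(p * z)\<^sup>2 * exp \<bar>p * z\<bar> \<le> (p * z)\<^sup>2 * exp p"
        using z assms by (intro mult_left_mono) (auto simp: abs_mult)
      also have "\<dots> = C2 * z\<^sup>2" by (simp add: C2_def power_mult_distrib)
      finally show ?thesis by simp
    qed
    finally have "\<bar>x + y\<bar> powr p \<le> \<bar>x\<bar> powr p * (1 + p * z + C2 * z\<^sup>2)"
      by (simp add: mult_left_mono)
    moreover have "\<bar>x\<bar> powr p * z = y * (sgn x * \<bar>x\<bar> powr (p - 1))"
    proof -
      have "\<bar>x\<bar> powr p = \<bar>x\<bar> * \<bar>x\<bar> powr (p - 1)" using x by (simp add: powr_mult_base)
      thus ?thesis using x by (simp add: z_def sgn_if field_simps)
    qed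
    moreover have "\<bar>x\<bar> powr p * z\<^sup>2 \<le> (1 + \<bar>y\<bar> powr p) * A"
    proof (cases "p \<le> 2")
      case True
      have "z\<^sup>2 = \<bar>z\<bar> powr 2" by (cases "z = 0") (auto simp: powr_numeral)
      also have "\<dots> \<le> \<bar>z\<bar> powr p"
        by (rule powr_mono') (use z True assms in auto)
      finally have "\<bar>x\<bar> powr p * z\<^sup>2 \<le> \<bar>x\<bar> powr p * \<bar>z\<bar> powr p"
        by (intro mult_left_mono) auto
      also have "\<dots> = \<bar>y\<bar> powr p * 1" using x by (simp add: z_def powr_mult[symmetric])
      also have "\<dots> \<le> (1 + \<bar>y\<bar> powr p) * A"
        using A by (intro mult_mono) auto
      finally show ?thesis .
    next
      case False
      have "\<bar>x\<bar> powr p = x\<^sup>2 * \<bar>x\<bar> powr (p - 2)"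
      proof -
        have "\<bar>x\<bar> powr p = \<bar>x\<bar> powr (2 + (p - 2))" by simp
        also have "\<dots> = \<bar>x\<bar> powr 2 * \<bar>x\<bar> powr (p - 2)" by (rule powr_add)
        finally show ?thesis using x by (simp add: powr_numeral)
      qed
      hence "\<bar>x\<bar> powr p * z\<^sup>2 = y\<^sup>2 * \<bar>x\<bar> powr (p - 2)"
        using x by (simp add: z_def power_divide)
      also have "\<dots> \<le> (1 + \<bar>y\<bar> powr p) * A"
      proof (intro mult_mono)
        show "y\<^sup>2 \<le> 1 + \<bar>y\<bar> powr p"
        proof (cases "\<bar>y\<bar> \<le> 1")
          case True
          hence "y\<^sup>2 \<le> 1" by (simp add: abs_square_le_1)
          moreover have "0 \<le> \<bar>y\<bar> powr p" by simp
          ultimately show ?thesis by linarith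
        next
          case y: False
          have "y\<^sup>2 = \<bar>y\<bar> powr 2" using y by (simp add: powr_numeral)
          also have "\<dots> \<le> \<bar>y\<bar> powr p" using y False by (intro powr_mono) auto
          finally show ?thesis by simp
        qed
        show "\<bar>x\<bar> powr (p - 2) \<le> A"
        \<comment> \<open>The Young step as a case split at the balance point of the two remainder
          terms: below it the power is at most the pure power of \<open>r\<close>, above it the
          square of \<open>x\<close> supplies the factor \<open>r\<close> by which
          \<open>\<bar>x\<bar> powr p\<close> is divided.\<close>
        proof (cases "x\<^sup>2 \<le> r")
          case True
          have "\<bar>x\<bar> powr (p - 2) = (x\<^sup>2) powr (p / 2 - 1)"
          proof -
            have "x\<^sup>2 = \<bar>x\<bar> powr 2" using x by (simp add: powr_numeral)
            hence "(x\<^sup>2) powr (p / 2 - 1) = \<bar>x\<bar> powr (2 * (p / 2 - 1))" by (simp only: powr_powr)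
            thus ?thesis by (simp add: right_diff_distrib)
          qed
          also have "\<dots> \<le> r powr (p / 2 - 1)"
            using True False by (intro powr_mono2) auto
          also have "\<dots> = r powr (max 1 (p / 2) - 1)" using False by simp
          finally show ?thesis using r by (auto simp: A_def intro: add_increasing)
        next
          case x2: False
          have "r * \<bar>x\<bar> powr (p - 2) \<le> x\<^sup>2 * \<bar>x\<bar> powr (p - 2)"
            using x2 by (intro mult_right_mono) auto
          hence "\<bar>x\<bar> powr (p - 2) \<le> \<bar>x\<bar> powr p / r"
            using r \<open>\<bar>x\<bar> powr p = _\<close> by (simp add: field_simps)
          thus ?thesis using r' by (simp add: A_def)
        qed
      qed (use A in auto)
      finally show ?thesis .
    qed
    hence "C2 * (\<bar>x\<bar> powr p * z\<^sup>2) \<le> C2 * ((1 + \<bar>y\<bar> powr p) * A)"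
      using C2 by (intro mult_left_mono) auto
    moreover have "\<dots> \<le> (1 + C1 + C2) * ((1 + \<bar>y\<bar> powr p) * A)"
      using C1 A by (intro mult_right_mono) auto
    ultimately have "\<bar>x + y\<bar> powr p \<le> \<bar>x\<bar> powr p + p * (y * (sgn x * \<bar>x\<bar> powr (p - 1)))
        + (1 + C1 + C2) * ((1 + \<bar>y\<bar> powr p) * A)"
      by (simp add: distrib_left mult_ac)
    thus ?thesis unfolding A_def by (simp add: mult.assoc)
  qed
qed

section \<open>Sums of independent random variables\<close>

text \<open>Independence is assumed for the family indexed by pairs of arm and time; this extracts
  one arm along any enumeration of distinct times. Events are transported to the image of
  \<open>f\<close> by the inverse of \<open>f\<close>, and the product formula is applied
  there.\<close>

lemma (in prob_space) indep_vars_reindex: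
  assumes indep: "indep_vars M' X I" and f: "inj_on f J" "f ` J \<subseteq> I"
  shows "indep_vars (\<lambda>j. M' (f j)) (\<lambda>j. X (f j)) J"
proof -
  define G where "G i = {X i -` A \<inter> space M | A. A \<in> sets (M' i)}" for i
  have G: "indep_sets G I" and rv: "\<And>i. i \<in> I \<Longrightarrow> random_variable (M' i) (X i)"
    using indep by (auto simp: indep_vars_def2 G_def[abs_def])
  have "indep_sets (\<lambda>j. G (f j)) J"
  proof (rule indep_setsI)
    show "G (f i) \<subseteq> events" if "i \<in> J" for i
      using G f that by (auto simp: indep_sets_def)
    fix A K assume K: "K \<noteq> {}" "K \<subseteq> J" "finite K" and A: "\<forall>j\<in>K. A j \<in> G (f j)"
    have inj: "inj_on f K" using f(1) K(2) by (rule inj_on_subset)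
    define A' where "A' i = A (the_inv_into K f i)" for i
    have A': "A' (f j) = A j" if "j \<in> K" for j
      using inj that by (simp add: A'_def the_inv_into_f_f)
    have "prob (\<Inter>i\<in>f ` K. A' i) = (\<Prod>i\<in>f ` K. prob (A' i))"
      using K f A A' by (intro indep_setsD[OF G]) auto
    also have "\<dots> = (\<Prod>j\<in>K. prob (A j))"
      using inj A' by (simp add: prod.reindex)
    also have "(\<Inter>i\<in>f ` K. A' i) = (\<Inter>j\<in>K. A j)" using A' by auto
    finally show "prob (\<Inter>j\<in>K. A j) = (\<Prod>j\<in>K. prob (A j))" .
  qed
  with rv f show ?thesis by (auto simp: indep_vars_def2 G_def)
qed

section \<open>Chernoff bounds\<close>

text \<open>The free exponent of Chernoff's method is absorbed into \<open>Y\<close>, so that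
  callers choose it by scaling their variables.\<close>

lemma (in prob_space) exponential_tail_bound:
  fixes Y :: "'i \<Rightarrow> 'a \<Rightarrow> real"
  assumes fin: "finite I"
    and indep: "indep_vars (\<lambda>_. borel) Y I"
    and int: "\<And>i. i \<in> I \<Longrightarrow> integrable M (\<lambda>\<omega>. exp (Y i \<omega>))"
    and le: "\<And>i. i \<in> I \<Longrightarrow> expectation (\<lambda>\<omega>. exp (Y i \<omega>)) \<le> exp (b i)"
  shows "prob {\<omega>\<in>space M. x \<le> (\<Sum>i\<in>I. Y i \<omega>)} \<le> exp ((\<Sum>i\<in>I. b i) - x)"
proof -
  have indep': "indep_vars (\<lambda>_. borel) (\<lambda>i \<omega>. exp (Y i \<omega>)) I"
    by (rule indep_vars_compose2[OF indep]) auto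
  have eq: "exp (\<Sum>i\<in>I. Y i \<omega>) = (\<Prod>i\<in>I. exp (Y i \<omega>))" for \<omega>
    by (rule exp_sum[OF fin])
  have int': "integrable M (\<lambda>\<omega>. exp (\<Sum>i\<in>I. Y i \<omega>))"
    unfolding eq by (rule indep_vars_integrable[OF fin indep' int])
  have "prob {\<omega>\<in>space M. exp x \<le> exp (\<Sum>i\<in>I. Y i \<omega>)}
      \<le> expectation (\<lambda>\<omega>. exp (\<Sum>i\<in>I. Y i \<omega>)) / exp x"
    by (rule integral_Markov_inequality_measure[OF int', where A = "space M"]) auto
  also have "expectation (\<lambda>\<omega>. exp (\<Sum>i\<in>I. Y i \<omega>)) = (\<Prod>i\<in>I. expectation (\<lambda>\<omega>. exp (Y i \<omega>)))"
    unfolding eq by (rule indep_vars_lebesgue_integral[OF fin indep' int])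
  also have "\<dots> \<le> (\<Prod>i\<in>I. exp (b i))"
    by (intro prod_mono) (auto intro!: le Bochner_Integration.integral_nonneg)
  also have "\<dots> = exp (\<Sum>i\<in>I. b i)" by (rule exp_sum[OF fin, symmetric])
  finally show ?thesis by (simp add: exp_diff divide_right_mono)
qed

lemma (in prob_space) exponential_abs_tail_bound:
  fixes Y :: "'i \<Rightarrow> 'a \<Rightarrow> real"
  assumes fin: "finite I"
    and indep: "indep_vars (\<lambda>_. borel) Y I"
    and int: "\<And>i c. i \<in> I \<Longrightarrow> \<bar>c\<bar> = 1 \<Longrightarrow> integrable M (\<lambda>\<omega>. exp (c * Y i \<omega>))"
    and le: "\<And>i c. i \<in> I \<Longrightarrow> \<bar>c\<bar> = 1 \<Longrightarrow> expectation (\<lambda>\<omega>. exp (c * Y i \<omega>)) \<le> exp (b i)"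
  shows "prob {\<omega>\<in>space M. x \<le> \<bar>\<Sum>i\<in>I. Y i \<omega>\<bar>} \<le> 2 * exp ((\<Sum>i\<in>I. b i) - x)"
proof -
  have [measurable]: "Y i \<in> borel_measurable M" if "i \<in> I" for i
    using indep that by (auto simp: indep_vars_def)
  have *: "prob {\<omega>\<in>space M. x \<le> (\<Sum>i\<in>I. c * Y i \<omega>)} \<le> exp ((\<Sum>i\<in>I. b i) - x)"
    if c: "\<bar>c\<bar> = 1" for c
    by (intro exponential_tail_bound fin int le c indep_vars_compose2[OF indep]) auto
  have sets: "{\<omega>\<in>space M. x \<le> (\<Sum>i\<in>I. c * Y i \<omega>)} \<in> events" for c
    by measurable
  have "prob {\<omega>\<in>space M. x \<le> \<bar>\<Sum>i\<in>I. Y i \<omega>\<bar>} \<le>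
      prob ({\<omega>\<in>space M. x \<le> (\<Sum>i\<in>I. 1 * Y i \<omega>)} \<union> {\<omega>\<in>space M. x \<le> (\<Sum>i\<in>I. (- 1) * Y i \<omega>)})"
    using sets[of 1] sets[of "- 1"] by (intro finite_measure_mono) (auto simp: sum_negf)
  also have "\<dots> \<le> prob {\<omega>\<in>space M. x \<le> (\<Sum>i\<in>I. 1 * Y i \<omega>)}
      + prob {\<omega>\<in>space M. x \<le> (\<Sum>i\<in>I. (- 1) * Y i \<omega>)}"
    by (intro measure_Un_le sets)
  also have "\<dots> \<le> 2 * exp ((\<Sum>i\<in>I. b i) - x)"
    using *[of 1] *[of "- 1"] by simp
  finally show ?thesis .
qed

text \<open>The linear term vanishes by centering. In the remainder one half of \<open>v\<close>
  controls \<open>exp \<bar>u * Y\<bar>\<close>, and the other half absorbs the square of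
  \<open>Y\<close>: with \<open>z = v / 2 * \<bar>Y\<bar>\<close> half the square of
  \<open>z\<close> is at most \<open>exp z\<close>, whence the constant 8, and the two factors
  \<open>exp z\<close> multiply to \<open>exp (v * \<bar>Y\<bar>)\<close>.\<close>

lemma (in prob_space) expectation_exp_le_quadratic:
  fixes Y :: "'a \<Rightarrow> real"
  assumes Y: "integrable M Y" "expectation Y = 0" and "0 < v"
    and exp: "integrable M (\<lambda>\<omega>. exp (v * Y \<omega>))" "integrable M (\<lambda>\<omega>. exp (- v * Y \<omega>))"
  shows "\<exists>K\<ge>0. \<forall>u. \<bar>u\<bar> \<le> v / 2 \<longrightarrow>
    integrable M (\<lambda>\<omega>. exp (u * Y \<omega>)) \<and> expectation (\<lambda>\<omega>. exp (u * Y \<omega>)) \<le> exp (K * u\<^sup>2)"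
proof -
  define G where "G \<omega> = exp (v * Y \<omega>) + exp (- v * Y \<omega>)" for \<omega>
  have G: "integrable M G" unfolding G_def using exp by auto
  have [measurable]: "Y \<in> borel_measurable M" using Y by auto
  have exp_abs: "exp (v * \<bar>y\<bar>) \<le> exp (v * y) + exp (- v * y)" for y :: real
    by (cases "0 \<le> y") auto
  have int: "integrable M (\<lambda>\<omega>. exp (u * Y \<omega>))" if u: "\<bar>u\<bar> \<le> v / 2" for u
  proof (rule Bochner_Integration.integrable_bound[OF G])
    show "AE \<omega> in M. norm (exp (u * Y \<omega>)) \<le> norm (G \<omega>)"
    proof (rule AE_I2)
      fix \<omega>
      have "u * Y \<omega> \<le> \<bar>u\<bar> * \<bar>Y \<omega>\<bar>" using abs_ge_self[of "u * Y \<omega>"] by (simp add: abs_mult)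
      also have "\<dots> \<le> v * \<bar>Y \<omega>\<bar>" using u \<open>0 < v\<close> by (intro mult_right_mono) auto
      finally have "exp (u * Y \<omega>) \<le> exp (v * \<bar>Y \<omega>\<bar>)" by simp
      also note exp_abs
      finally show "norm (exp (u * Y \<omega>)) \<le> norm (G \<omega>)"
        by (simp add: G_def)
    qed
  qed measurable
  have "expectation (\<lambda>\<omega>. exp (u * Y \<omega>)) \<le> exp (8 / v\<^sup>2 * expectation G * u\<^sup>2)"
    if u: "\<bar>u\<bar> \<le> v / 2" for u
  proof -
    have "expectation (\<lambda>\<omega>. exp (u * Y \<omega>)) \<le> expectation (\<lambda>\<omega>. 1 + u * Y \<omega> + u\<^sup>2 * (8 / v\<^sup>2) * G \<omega>)"
    proof (intro integral_mono int u)
      show "integrable M (\<lambda>\<omega>. 1 + u * Y \<omega> + u\<^sup>2 * (8 / v\<^sup>2) * G \<omega>)"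
        using Y G by simp
      fix \<omega>
      define z where "z = v / 2 * \<bar>Y \<omega>\<bar>"
      have z: "0 \<le> z" using \<open>0 < v\<close> by (simp add: z_def)
      have "z\<^sup>2 / 2 \<le> exp z" using exp_lower_Taylor_quadratic[OF z] z by simp
      have "\<bar>u * Y \<omega>\<bar> \<le> z"
        unfolding z_def abs_mult by (intro mult_right_mono u) auto
      have "exp (u * Y \<omega>) \<le> 1 + u * Y \<omega> + (u * Y \<omega>)\<^sup>2 * exp \<bar>u * Y \<omega>\<bar>"
        by (rule exp_le_quadratic_abs)
      also have "(u * Y \<omega>)\<^sup>2 * exp \<bar>u * Y \<omega>\<bar> \<le> (u * Y \<omega>)\<^sup>2 * exp z"
        using \<open>\<bar>u * Y \<omega>\<bar> \<le> z\<close> by (intro mult_left_mono) auto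
      also have "(u * Y \<omega>)\<^sup>2 = u\<^sup>2 * (8 / v\<^sup>2) * (z\<^sup>2 / 2)"
        using \<open>0 < v\<close> by (simp add: z_def power_mult_distrib power_divide)
      also have "u\<^sup>2 * (8 / v\<^sup>2) * (z\<^sup>2 / 2) * exp z \<le> u\<^sup>2 * (8 / v\<^sup>2) * exp z * exp z"
        using \<open>z\<^sup>2 / 2 \<le> exp z\<close> by (intro mult_right_mono mult_left_mono) auto
      also have "\<dots> = u\<^sup>2 * (8 / v\<^sup>2) * exp (v * \<bar>Y \<omega>\<bar>)"
        by (simp add: z_def mult_exp_exp)
      also have "\<dots> \<le> u\<^sup>2 * (8 / v\<^sup>2) * G \<omega>"
        unfolding G_def by (intro mult_left_mono exp_abs) auto
      finally show "exp (u * Y \<omega>) \<le> 1 + u * Y \<omega> + u\<^sup>2 * (8 / v\<^sup>2) * G \<omega>" by simp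
    qed
    also have "\<dots> = 1 + 8 / v\<^sup>2 * expectation G * u\<^sup>2"
      using Y G by (simp add: prob_space)
    also have "\<dots> \<le> exp (8 / v\<^sup>2 * expectation G * u\<^sup>2)" by (rule exp_ge_add_one_self)
    finally show ?thesis .
  qed
  moreover have "0 \<le> 8 / v\<^sup>2 * expectation G"
    by (auto simp: G_def intro!: mult_nonneg_nonneg Bochner_Integration.integral_nonneg)
  ultimately show ?thesis using int by blast
qed

section \<open>Absolute moments of centered sums\<close>

text \<open>\<open>K\<close> is chosen before the family and the index set, so that one constant
  covers all arms and all sets of observation times.\<close>

lemma (in prob_space) moment_sum_bound:
  fixes p :: real
  assumes p: "1 < p" and u: "0 \<le> u"
  shows "\<exists>K\<ge>0. \<forall>(Y :: 'i \<Rightarrow> 'a \<Rightarrow> real) I. finite I \<longrightarrow> indep_vars (\<lambda>_. borel) Y I \<longrightarrow>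
    (\<forall>i\<in>I. integrable M (Y i) \<and> expectation (Y i) = 0 \<and>
       integrable M (\<lambda>\<omega>. \<bar>Y i \<omega>\<bar> powr p) \<and> expectation (\<lambda>\<omega>. \<bar>Y i \<omega>\<bar> powr p) \<le> u) \<longrightarrow>
    integrable M (\<lambda>\<omega>. \<bar>\<Sum>i\<in>I. Y i \<omega>\<bar> powr p) \<and>
    expectation (\<lambda>\<omega>. \<bar>\<Sum>i\<in>I. Y i \<omega>\<bar> powr p) \<le> K * real (card I) powr (max 1 (p / 2))"
proof -
  obtain C where C: "1 \<le> C" and Cle: "\<And>x y r :: real. 1 \<le> r \<Longrightarrow>
    \<bar>x + y\<bar> powr p \<le> \<bar>x\<bar> powr p + p * y * (sgn x * \<bar>x\<bar> powr (p - 1)) +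
      C * (1 + \<bar>y\<bar> powr p) * (\<bar>x\<bar> powr p / r + r powr (max 1 (p / 2) - 1))"
    using abs_add_powr_le[OF p] by blast
  define \<kappa> where "\<kappa> = max 1 (p / 2)"
  define G where "G = C * (1 + u)"
  have "1 * (1 + u) \<le> G"
    unfolding G_def using C u by (intro mult_right_mono) auto
  with u have G: "1 \<le> G" "u \<le> G" by auto
  \<comment> \<open>Adding a variable to \<open>s\<close> others, with scale
    \<open>r = 2 * G * s\<close>, increases the moment bound by at most
    \<open>G * (K * s powr \<kappa> / r + r powr (\<kappa> - 1))\<close>. This \<open>K\<close>
    makes each of the two terms equal to \<open>K / 2 * s powr (\<kappa> - 1)\<close>, and
    \<open>s powr \<kappa> + s powr (\<kappa> - 1)\<close> is at most
    \<open>(s + 1) powr \<kappa>\<close>.\<close>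
  define K where "K = 2 * G * (2 * G) powr (\<kappa> - 1)"
  have \<kappa>: "1 \<le> \<kappa>" by (simp add: \<kappa>_def)
  have "1 \<le> (2 * G) powr (\<kappa> - 1)" using G \<kappa> by (intro ge_one_powr_ge_zero) auto
  hence GK: "2 * G \<le> K" using G unfolding K_def by simp
  have main: "integrable M (\<lambda>\<omega>. \<bar>\<Sum>i\<in>I. Y i \<omega>\<bar> powr p) \<and>
      expectation (\<lambda>\<omega>. \<bar>\<Sum>i\<in>I. Y i \<omega>\<bar> powr p) \<le> K * real (card I) powr \<kappa>"
    if "finite I" "indep_vars (\<lambda>_. borel) Y I"
      "\<forall>i\<in>I. integrable M (Y i) \<and> expectation (Y i) = 0 \<and>
         integrable M (\<lambda>\<omega>. \<bar>Y i \<omega>\<bar> powr p) \<and> expectation (\<lambda>\<omega>. \<bar>Y i \<omega>\<bar> powr p) \<le> u"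
    for Y :: "'i \<Rightarrow> 'a \<Rightarrow> real" and I
    using that
  proof (induction I rule: finite_induct)
    case (insert j I)
    note Y = insert.prems(2)[rule_format]
    have indepI: "indep_vars (\<lambda>_. borel) Y I"
      using insert.prems(1) by (rule indep_vars_subset) auto
    define S where "S \<omega> = (\<Sum>i\<in>I. Y i \<omega>)" for \<omega>
    define s where "s = real (card I)"
    have IH: "integrable M (\<lambda>\<omega>. \<bar>S \<omega>\<bar> powr p)" "expectation (\<lambda>\<omega>. \<bar>S \<omega>\<bar> powr p) \<le> K * s powr \<kappa>"
      using insert.IH[OF indepI] insert.prems(2) by (auto simp: S_def s_def)
    have sum_insert: "(\<Sum>i\<in>insert j I. Y i \<omega>) = S \<omega> + Y j \<omega>" for \<omega>
      using insert.hyps by (simp add: S_def)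
    have card: "real (card (insert j I)) = s + 1" using insert.hyps by (simp add: s_def)
    have [measurable]: "Y i \<in> borel_measurable M" if "i \<in> insert j I" for i
      using Y[OF that] by auto
    have [measurable]: "S \<in> borel_measurable M" unfolding S_def by measurable
    have indep: "indep_var borel (Y j) borel S"
      using indep_vars_sum[OF insert.hyps insert.prems(1)] by (simp add: S_def[abs_def])
    show ?case
    proof (cases "I = {}")
      case True
      have "u \<le> K" using G GK by simp
      with Y[of j] True show ?thesis by simp
    next
      case False
      hence s: "1 \<le> s"
        using insert.hyps by (simp add: s_def Suc_le_eq card_gt_0_iff)
      define r where "r = 2 * G * s"
      have r: "1 \<le> r" using mult_mono[of 1 "2 * G" 1 s] G s by (simp add: r_def)
      define V where "V \<omega> = sgn (S \<omega>) * \<bar>S \<omega>\<bar> powr (p - 1)" for \<omega>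
      define Z where "Z \<omega> = \<bar>S \<omega>\<bar> powr p / r + r powr (\<kappa> - 1)" for \<omega>
      define R where "R \<omega> = \<bar>S \<omega>\<bar> powr p + p * (Y j \<omega> * V \<omega>)
          + C * ((1 + \<bar>Y j \<omega>\<bar> powr p) * Z \<omega>)" for \<omega>
      have le: "\<bar>S \<omega> + Y j \<omega>\<bar> powr p \<le> R \<omega>" for \<omega>
        using Cle[OF r, of "S \<omega>" "Y j \<omega>"] by (simp add: R_def V_def Z_def \<kappa>_def mult.assoc)
      have V: "integrable M V"
      proof (rule Bochner_Integration.integrable_bound)
        show "integrable M (\<lambda>\<omega>. 1 + \<bar>S \<omega>\<bar> powr p)" using IH by simp
        show "AE \<omega> in M. norm (V \<omega>) \<le> norm (1 + \<bar>S \<omega>\<bar> powr p)"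
        proof (rule AE_I2)
          fix \<omega>
          have "\<bar>S \<omega>\<bar> powr (p - 1) \<le> 1 + \<bar>S \<omega>\<bar> powr p"
          proof (cases "\<bar>S \<omega>\<bar> \<le> 1")
            case True
            hence "\<bar>S \<omega>\<bar> powr (p - 1) \<le> 1" using p by (intro powr_le1) auto
            thus ?thesis by (simp add: add_increasing2)
          next
            case False
            hence "\<bar>S \<omega>\<bar> powr (p - 1) \<le> \<bar>S \<omega>\<bar> powr p" by (intro powr_mono) auto
            thus ?thesis by simp
          qed
          thus "norm (V \<omega>) \<le> norm (1 + \<bar>S \<omega>\<bar> powr p)"
            by (auto simp: V_def abs_mult sgn_if)
        qed
      qed (simp add: V_def[abs_def])
      have Z: "integrable M Z" unfolding Z_def using IH by simp
      have YV: "indep_var borel (Y j) borel V"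
        using indep_var_compose[OF indep, of "\<lambda>x. x" borel "\<lambda>x. sgn x * \<bar>x\<bar> powr (p - 1)" borel]
        by (simp add: comp_def V_def[abs_def])
      have YZ: "indep_var borel (\<lambda>\<omega>. 1 + \<bar>Y j \<omega>\<bar> powr p) borel Z"
        using indep_var_compose[OF indep, of "\<lambda>x. 1 + \<bar>x\<bar> powr p" borel
            "\<lambda>x. \<bar>x\<bar> powr p / r + r powr (\<kappa> - 1)" borel]
        by (simp add: comp_def Z_def[abs_def])
      have int1: "integrable M (\<lambda>\<omega>. 1 + \<bar>Y j \<omega>\<bar> powr p)" using Y[of j] by simp
      have intYV: "integrable M (\<lambda>\<omega>. Y j \<omega> * V \<omega>)"
        using Y[of j] by (intro indep_var_integrable YV V) auto
      have intYZ: "integrable M (\<lambda>\<omega>. (1 + \<bar>Y j \<omega>\<bar> powr p) * Z \<omega>)"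
        by (intro indep_var_integrable YZ Z int1)
      have R: "integrable M R" unfolding R_def using IH intYV intYZ by simp
      have int: "integrable M (\<lambda>\<omega>. \<bar>S \<omega> + Y j \<omega>\<bar> powr p)"
        by (rule Bochner_Integration.integrable_bound[OF R])
           (auto intro!: AE_I2 order_trans[OF le])
      have "expectation (\<lambda>\<omega>. \<bar>S \<omega> + Y j \<omega>\<bar> powr p) \<le> expectation R"
        by (intro integral_mono int R le)
      also have "expectation R = expectation (\<lambda>\<omega>. \<bar>S \<omega>\<bar> powr p)
          + p * expectation (\<lambda>\<omega>. Y j \<omega> * V \<omega>)
          + C * expectation (\<lambda>\<omega>. (1 + \<bar>Y j \<omega>\<bar> powr p) * Z \<omega>)"
        unfolding R_def using IH intYV intYZ by simp
      also have "expectation (\<lambda>\<omega>. Y j \<omega> * V \<omega>) = 0"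
        using Y[of j] by (subst indep_var_lebesgue_integral[OF YV _ V]) auto
      also have "expectation (\<lambda>\<omega>. (1 + \<bar>Y j \<omega>\<bar> powr p) * Z \<omega>)
          = (1 + expectation (\<lambda>\<omega>. \<bar>Y j \<omega>\<bar> powr p)) * expectation Z"
        using Y[of j] by (subst indep_var_lebesgue_integral[OF YZ int1 Z]) (simp add: prob_space)
      also have "C * \<dots> \<le> C * ((1 + u) * expectation Z)"
        using Y[of j] C r by (intro mult_left_mono mult_right_mono) (auto simp: Z_def)
      also have "\<dots> = G * expectation Z" by (simp add: G_def)
      also have "expectation Z = expectation (\<lambda>\<omega>. \<bar>S \<omega>\<bar> powr p) / r + r powr (\<kappa> - 1)"
        unfolding Z_def using IH by (simp add: prob_space)
      also have "\<dots> \<le> K * s powr \<kappa> / r + r powr (\<kappa> - 1)"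
        using IH(2) r by (intro add_right_mono divide_right_mono) auto
      also have "\<dots> = K * s powr (\<kappa> - 1) / (2 * G) + (2 * G) powr (\<kappa> - 1) * s powr (\<kappa> - 1)"
        using G s by (simp add: r_def powr_mult powr_diff)
      also have "G * \<dots> = K * s powr (\<kappa> - 1)"
        using G by (simp add: K_def field_simps)
      finally have "expectation (\<lambda>\<omega>. \<bar>S \<omega> + Y j \<omega>\<bar> powr p) \<le> K * (s powr \<kappa> + s powr (\<kappa> - 1))"
        using IH(2) G by (simp add: algebra_simps)
      also have "s powr \<kappa> + s powr (\<kappa> - 1) = (s + 1) * s powr (\<kappa> - 1)"
        using s by (simp add: algebra_simps powr_mult_base)
      also have "\<dots> \<le> (s + 1) * (s + 1) powr (\<kappa> - 1)"
        using s \<kappa> by (intro mult_left_mono powr_mono2) auto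
      also have "\<dots> = (s + 1) powr \<kappa>" using s by (simp add: powr_mult_base)
      finally have "expectation (\<lambda>\<omega>. \<bar>S \<omega> + Y j \<omega>\<bar> powr p) \<le> K * (s + 1) powr \<kappa>"
        using GK G by (simp add: mult_left_mono)
      thus ?thesis unfolding sum_insert card using int by simp
    qed
  qed simp
  have "0 \<le> K" using G by (simp add: K_def)
  with main show ?thesis unfolding \<kappa>_def by blast
qed

text \<open>With \<open>D\<close> the largest truncation level, \<open>u * D powr - p = \<eta>\<close> and the deviation is \<open>4 * \<eta> * D\<close>:
  the bias uses up \<open>p * \<eta> * D \<le> 2 * \<eta> * D\<close> of it, and Chernoff's bound with exponent \<open>1 / D\<close> the rest.\<close>

lemma (in prob_space) truncated_mean_tail_bound:
  fixes Y :: "nat \<Rightarrow> 'a \<Rightarrow> real"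
  assumes n: "1 \<le> n" and p: "1 < p" "p \<le> 2" and u: "0 < u" and lam: "0 < \<eta>"
    and indep: "indep_vars (\<lambda>_. borel) Y {1..n}"
    and Y: "\<And>k. k \<in> {1..n} \<Longrightarrow> integrable M (Y k)"
      "\<And>k. k \<in> {1..n} \<Longrightarrow> expectation (Y k) = \<theta>"
      "\<And>k. k \<in> {1..n} \<Longrightarrow> integrable M (\<lambda>\<omega>. \<bar>Y k \<omega>\<bar> powr p)"
      "\<And>k. k \<in> {1..n} \<Longrightarrow> expectation (\<lambda>\<omega>. \<bar>Y k \<omega>\<bar> powr p) \<le> u"
  shows "prob {\<omega>\<in>space M. 4 * (u powr (1 / p) * \<eta> powr ((p - 1) / p)) <
      \<bar>(\<Sum>k=1..n. if \<bar>Y k \<omega>\<bar> \<le> (u * real k / (\<eta> * real n)) powr (1 / p) then Y k \<omega> else 0) / real n - \<theta>\<bar>}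
    \<le> 2 * exp (- \<eta> * real n)"
proof -
  define L where "L k = (u * real k / (\<eta> * real n)) powr (1 / p)" for k :: nat
  define D where "D = (u / \<eta>) powr (1 / p)"
  define \<phi> where "\<phi> k y = (if \<bar>y\<bar> \<le> L k then y else 0)" for k and y :: real
  define \<mu> where "\<mu> k = expectation (\<lambda>\<omega>. \<phi> k (Y k \<omega>))" for k
  have D: "0 < D" using u lam by (simp add: D_def)
  have D_powr: "D powr p = u / \<eta>" using p u lam by (simp add: D_def powr_powr)
  have uD: "u * D powr (- p) = \<eta>" using u lam by (simp add: powr_minus D_powr)
  have L: "L k = D * (real k / real n) powr (1 / p)" for k
  proof -
    have "u * real k / (\<eta> * real n) = (u / \<eta>) * (real k / real n)" by simp
    thus ?thesis unfolding L_def D_def using u lam by (simp only: powr_mult)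
  qed
  have L_pos: "0 < L k" if "k \<in> {1..n}" for k using that D by (simp add: L)
  have L_le: "L k \<le> D" if "k \<in> {1..n}" for k
  proof -
    have "(real k / real n) powr (1 / p) \<le> 1" using that p by (intro powr_le1) auto
    with D show ?thesis by (simp add: L mult_left_le)
  qed
  have [measurable]: "Y k \<in> borel_measurable M" if "k \<in> {1..n}" for k using Y(1)[OF that] by auto
  have [measurable]: "\<phi> k \<in> borel_measurable borel" for k unfolding \<phi>_def by measurable
  have \<phi>: "\<bar>\<phi> k y\<bar> \<le> D" if "k \<in> {1..n}" for k y using L_le[OF that] D by (auto simp: \<phi>_def)
  \<comment> \<open>The truncation jumps at its level, so integrability is obtained for continuous
    functions of its values, which lie in the compact interval from \<open>- D\<close> to
    \<open>D\<close>.\<close>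
  have bounded: "integrable M (\<lambda>\<omega>. g (\<phi> k (Y k \<omega>)))"
    if k: "k \<in> {1..n}" and g: "continuous_on UNIV g" for k and g :: "real \<Rightarrow> real"
  proof -
    have "compact (g ` {- D..D})"
      using g by (intro compact_continuous_image) (auto intro: continuous_on_subset)
    then obtain c where c: "\<And>x. x \<in> {- D..D} \<Longrightarrow> \<bar>g x\<bar> \<le> c"
      using compact_imp_bounded bounded_iff by (metis imageI real_norm_def)
    have [measurable]: "g \<in> borel_measurable borel" using g by (rule borel_measurable_continuous_onI)
    show ?thesis
    proof (rule integrable_const_bound[where B = c])
      show "AE \<omega> in M. norm (g (\<phi> k (Y k \<omega>))) \<le> c"
        using c \<phi>[OF k] by (auto simp: abs_le_iff minus_le_iff)
    qed (use k in measurable)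
  qed
  have int_\<phi>: "integrable M (\<lambda>\<omega>. \<phi> k (Y k \<omega>))" if "k \<in> {1..n}" for k
    using bounded[OF that, of "\<lambda>x. x"] by simp
  \<comment> \<open>Truncation trades the missing second moment for the \<open>p\<close>-th one:
    below the level, the surplus power \<open>2 - p\<close> costs at most
    \<open>D powr (2 - p)\<close>.\<close>
  have second_moment: "expectation (\<lambda>\<omega>. (\<phi> k (Y k \<omega>))\<^sup>2) \<le> \<eta> * D\<^sup>2" if k: "k \<in> {1..n}" for k
  proof -
    have "expectation (\<lambda>\<omega>. (\<phi> k (Y k \<omega>))\<^sup>2) \<le> expectation (\<lambda>\<omega>. D powr (2 - p) * \<bar>Y k \<omega>\<bar> powr p)"
    proof (intro integral_mono)
      show "integrable M (\<lambda>\<omega>. (\<phi> k (Y k \<omega>))\<^sup>2)"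
        by (rule bounded[OF k, of "\<lambda>x. x\<^sup>2"]) (intro continuous_intros)
      show "integrable M (\<lambda>\<omega>. D powr (2 - p) * \<bar>Y k \<omega>\<bar> powr p)" using Y(3)[OF k] by simp
      fix \<omega>
      show "(\<phi> k (Y k \<omega>))\<^sup>2 \<le> D powr (2 - p) * \<bar>Y k \<omega>\<bar> powr p"
      proof (cases "\<bar>Y k \<omega>\<bar> \<le> L k \<and> Y k \<omega> \<noteq> 0")
        case True
        have "(\<phi> k (Y k \<omega>))\<^sup>2 = \<bar>Y k \<omega>\<bar> powr (2 - p) * \<bar>Y k \<omega>\<bar> powr p"
          using True by (simp add: \<phi>_def powr_add[symmetric])
        also have "\<dots> \<le> D powr (2 - p) * \<bar>Y k \<omega>\<bar> powr p"
          using True L_le[OF k] p by (intro mult_right_mono powr_mono2) auto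
        finally show ?thesis .
      qed (auto simp: \<phi>_def)
    qed
    also have "\<dots> \<le> D powr (2 - p) * u" using Y(4)[OF k] by (simp add: mult_left_mono)
    also have "D powr (2 - p) = D\<^sup>2 * D powr (- p)"
      using D powr_add[of D 2 "- p"] by (simp add: powr_numeral)
    finally show ?thesis by (simp add: uD[symmetric] mult_ac)
  qed
  \<comment> \<open>The quadratic bound is applied to the uncentered variable, whose quotient by
    \<open>D\<close> is at most 1 in absolute value as required; the mean then appears in the
    exponent and cancels against the centering factor.\<close>
  have mgf: "expectation (\<lambda>\<omega>. exp (c * ((\<phi> k (Y k \<omega>) - \<mu> k) / D))) \<le> exp \<eta>"
    if k: "k \<in> {1..n}" and c: "\<bar>c\<bar> = 1" for k c
  proof -
    have c2: "c\<^sup>2 = 1" using c by (metis power2_abs power_one)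
    have "expectation (\<lambda>\<omega>. exp (c * \<phi> k (Y k \<omega>) / D))
        \<le> expectation (\<lambda>\<omega>. 1 + c / D * \<phi> k (Y k \<omega>) + (\<phi> k (Y k \<omega>))\<^sup>2 / D\<^sup>2)"
    proof (intro integral_mono)
      show "integrable M (\<lambda>\<omega>. exp (c * \<phi> k (Y k \<omega>) / D))"
        using D by (intro bounded[OF k, of "\<lambda>x. exp (c * x / D)"] continuous_intros) auto
      show "integrable M (\<lambda>\<omega>. 1 + c / D * \<phi> k (Y k \<omega>) + (\<phi> k (Y k \<omega>))\<^sup>2 / D\<^sup>2)"
        using D by (intro bounded[OF k, of "\<lambda>x. 1 + c / D * x + x\<^sup>2 / D\<^sup>2"] continuous_intros) auto
      fix \<omega>
      have "\<bar>c * \<phi> k (Y k \<omega>) / D\<bar> \<le> 1" using \<phi>[OF k, of "Y k \<omega>"] D c by (simp add: abs_mult)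
      hence "exp (c * \<phi> k (Y k \<omega>) / D) \<le> 1 + c * \<phi> k (Y k \<omega>) / D + (c * \<phi> k (Y k \<omega>) / D)\<^sup>2"
        by (rule exp_le_quadratic[OF abs_le_D1])
      thus "exp (c * \<phi> k (Y k \<omega>) / D) \<le> 1 + c / D * \<phi> k (Y k \<omega>) + (\<phi> k (Y k \<omega>))\<^sup>2 / D\<^sup>2"
        using c2 by (simp add: power_mult_distrib power_divide)
    qed
    also have "\<dots> = 1 + c / D * \<mu> k + expectation (\<lambda>\<omega>. (\<phi> k (Y k \<omega>))\<^sup>2) / D\<^sup>2"
      using int_\<phi>[OF k] bounded[OF k, of "\<lambda>x. x\<^sup>2"]
      by (simp add: \<mu>_def prob_space continuous_intros)
    also have "\<dots> \<le> 1 + (c / D * \<mu> k + \<eta>)"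
      using second_moment[OF k] D by (simp add: field_simps)
    also have "\<dots> \<le> exp (c / D * \<mu> k + \<eta>)" by (rule exp_ge_add_one_self)
    finally have le: "expectation (\<lambda>\<omega>. exp (c * \<phi> k (Y k \<omega>) / D)) \<le> exp (c / D * \<mu> k + \<eta>)" .
    have "expectation (\<lambda>\<omega>. exp (c * ((\<phi> k (Y k \<omega>) - \<mu> k) / D)))
        = expectation (\<lambda>\<omega>. exp (- (c / D * \<mu> k)) * exp (c * \<phi> k (Y k \<omega>) / D))"
      by (simp add: mult_exp_exp diff_divide_distrib right_diff_distrib)
    also have "\<dots> = exp (- (c / D * \<mu> k)) * expectation (\<lambda>\<omega>. exp (c * \<phi> k (Y k \<omega>) / D))"
      by simp
    also have "\<dots> \<le> exp (- (c / D * \<mu> k)) * exp (c / D * \<mu> k + \<eta>)"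
      using le by (intro mult_left_mono) auto
    also have "\<dots> = exp \<eta>" by (simp add: mult_exp_exp)
    finally show ?thesis .
  qed
  \<comment> \<open>Above the level, \<open>\<bar>Y\<bar> powr (1 - p)\<close> is at most the same
    power of the level. Early observations have low levels and hence a large bias, but the exponent
    \<open>1 / p - 1\<close> exceeds -1, so the average stays bounded.\<close>
  have bias: "\<bar>\<mu> k - \<theta>\<bar> \<le> \<eta> * D * (real k / real n) powr (1 / p - 1)" if k: "k \<in> {1..n}" for k
  proof -
    have "\<bar>\<mu> k - \<theta>\<bar> = \<bar>expectation (\<lambda>\<omega>. \<phi> k (Y k \<omega>) - Y k \<omega>)\<bar>"
      using int_\<phi>[OF k] Y(1,2)[OF k] by (simp add: \<mu>_def)
    also have "\<dots> \<le> expectation (\<lambda>\<omega>. \<bar>\<phi> k (Y k \<omega>) - Y k \<omega>\<bar>)" by (rule integral_abs_bound)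
    also have "\<dots> \<le> expectation (\<lambda>\<omega>. L k powr (1 - p) * \<bar>Y k \<omega>\<bar> powr p)"
    proof (intro integral_mono)
      show "integrable M (\<lambda>\<omega>. \<bar>\<phi> k (Y k \<omega>) - Y k \<omega>\<bar>)" using int_\<phi>[OF k] Y(1)[OF k] by simp
      show "integrable M (\<lambda>\<omega>. L k powr (1 - p) * \<bar>Y k \<omega>\<bar> powr p)" using Y(3)[OF k] by simp
      fix \<omega>
      show "\<bar>\<phi> k (Y k \<omega>) - Y k \<omega>\<bar> \<le> L k powr (1 - p) * \<bar>Y k \<omega>\<bar> powr p"
      proof (cases "\<bar>Y k \<omega>\<bar> \<le> L k")
        case False
        have "\<bar>Y k \<omega>\<bar> = \<bar>Y k \<omega>\<bar> powr (1 - p) * \<bar>Y k \<omega>\<bar> powr p"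
          using False L_pos[OF k] by (simp add: powr_add[symmetric])
        also have "\<dots> \<le> L k powr (1 - p) * \<bar>Y k \<omega>\<bar> powr p"
          using False L_pos[OF k] p by (intro mult_right_mono powr_mono2') auto
        finally show ?thesis using False by (simp add: \<phi>_def)
      qed (simp add: \<phi>_def)
    qed
    also have "\<dots> \<le> L k powr (1 - p) * u" using Y(4)[OF k] by (simp add: mult_left_mono)
    also have "L k powr (1 - p) = D powr (1 - p) * (real k / real n) powr (1 / p - 1)"
      using D p by (simp add: L powr_mult powr_powr diff_divide_distrib)
    also have "D powr (1 - p) = D * D powr (- p)"
      using D by (simp add: powr_mult_base)
    finally show ?thesis by (simp add: uD[symmetric] mult_ac)
  qed
  have bias_sum: "\<bar>(\<Sum>k=1..n. \<mu> k - \<theta>)\<bar> \<le> 2 * (\<eta> * D) * real n"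
  proof -
    have "\<bar>(\<Sum>k=1..n. \<mu> k - \<theta>)\<bar> \<le> (\<Sum>k=1..n. \<eta> * D * (real k / real n) powr (1 / p - 1))"
      by (intro sum_abs[THEN order_trans] sum_mono bias)
    also have "\<dots> = \<eta> * D * (\<Sum>k=1..n. real k powr (1 / p - 1)) / real n powr (1 / p - 1)"
      by (simp add: powr_divide sum_distrib_left sum_divide_distrib)
    also have "\<dots> \<le> \<eta> * D * (real n powr (1 / p) / (1 / p)) / real n powr (1 / p - 1)"
      using p lam D by (intro divide_right_mono mult_left_mono sum_powr_le) auto
    \<comment> \<open>The factor \<open>p\<close> is the denominator in \<open>sum_powr_le\<close>
      for the exponent \<open>1 / p\<close>.\<close>
    also have "\<dots> = p * (\<eta> * D) * real n"
      using n by (simp add: powr_diff)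
    also have "\<dots> \<le> 2 * (\<eta> * D) * real n"
      using p lam D by (intro mult_right_mono) auto
    finally show ?thesis .
  qed
  have scale: "u powr (1 / p) * \<eta> powr ((p - 1) / p) = \<eta> * D"
  proof -
    have "\<eta> powr ((p - 1) / p) = \<eta> powr (1 - 1 / p)" using p by (simp add: field_simps)
    thus ?thesis using u lam by (simp add: D_def powr_divide powr_diff)
  qed
  have indep': "indep_vars (\<lambda>_. borel) (\<lambda>k \<omega>. (\<phi> k (Y k \<omega>) - \<mu> k) / D) {1..n}"
    by (rule indep_vars_compose2[OF indep]) auto
  have "prob {\<omega>\<in>space M. 4 * (\<eta> * D) < \<bar>(\<Sum>k=1..n. \<phi> k (Y k \<omega>)) / real n - \<theta>\<bar>}
      \<le> prob {\<omega>\<in>space M. 2 * \<eta> * real n \<le> \<bar>\<Sum>k=1..n. (\<phi> k (Y k \<omega>) - \<mu> k) / D\<bar>}"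
  proof (intro finite_measure_mono subsetI CollectI conjI)
    show "{\<omega>\<in>space M. 2 * \<eta> * real n \<le> \<bar>\<Sum>k=1..n. (\<phi> k (Y k \<omega>) - \<mu> k) / D\<bar>} \<in> events"
      by measurable
    fix \<omega> assume \<omega>: "\<omega> \<in> {\<omega>\<in>space M. 4 * (\<eta> * D) < \<bar>(\<Sum>k=1..n. \<phi> k (Y k \<omega>)) / real n - \<theta>\<bar>}"
    thus "\<omega> \<in> space M" by simp
    have "4 * (\<eta> * D) * real n < \<bar>(\<Sum>k=1..n. \<phi> k (Y k \<omega>)) / real n - \<theta>\<bar> * real n"
      using \<omega> n by simp
    also have "\<dots> = \<bar>((\<Sum>k=1..n. \<phi> k (Y k \<omega>)) / real n - \<theta>) * real n\<bar>" by (simp add: abs_mult)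
    also have "((\<Sum>k=1..n. \<phi> k (Y k \<omega>)) / real n - \<theta>) * real n
        = (\<Sum>k=1..n. \<phi> k (Y k \<omega>) - \<mu> k) + (\<Sum>k=1..n. \<mu> k - \<theta>)"
      using n by (simp add: left_diff_distrib sum_subtractf)
    finally have "2 * (\<eta> * D) * real n \<le> \<bar>\<Sum>k=1..n. \<phi> k (Y k \<omega>) - \<mu> k\<bar>"
      using bias_sum by linarith
    thus "2 * \<eta> * real n \<le> \<bar>\<Sum>k=1..n. (\<phi> k (Y k \<omega>) - \<mu> k) / D\<bar>"
      using D by (simp add: sum_divide_distrib[symmetric] field_simps)
  qed
  \<comment> \<open>The exponents of the single factors add up to half the threshold, which leaves
    exactly the rate \<open>\<eta>\<close>.\<close>
  also have "\<dots> \<le> 2 * exp ((\<Sum>k=1..n. \<eta>) - 2 * \<eta> * real n)"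
  proof (rule exponential_abs_tail_bound[OF _ indep'])
    show "integrable M (\<lambda>\<omega>. exp (c * ((\<phi> k (Y k \<omega>) - \<mu> k) / D)))" if "k \<in> {1..n}" for k c
      using D by (intro bounded[OF that, of "\<lambda>x. exp (c * ((x - \<mu> k) / D))"] continuous_intros) auto
  qed (use mgf in auto)
  finally show ?thesis
    unfolding scale \<phi>_def L_def by (simp add: mult_ac)
qed

section \<open>Exploration times\<close>

lemma finite_explored [simp]: "finite (explored B t)"
  by (induction t) auto

lemma explored_subset: "explored B t \<subseteq> {2..t}"
  by (induction t) (auto split: if_splits)

lemma explored_iff_restrict: "s \<le> t \<Longrightarrow> s \<in> explored B t \<longleftrightarrow> s \<in> explored B s"
proof (induction t)
  case (Suc t)
  show ?case
  proof (cases "s = Suc t")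
    case False
    with Suc show ?thesis by auto
  qed simp
qed simp

lemma budget_le_card_explored:
  assumes "2 \<le> t" "t \<notin> explored B t"
  shows "B t \<le> real (card (explored B (t - 1)))"
  using assms by (cases t) (auto split: if_splits)

text \<open>A count strictly below an integer budget stays within it after one more exploration. The
  absence of rounding loss gives the exact ceilings in (i) and (iv); a real budget can be overshot
  by less than one.\<close>

lemma card_explored_le_nat:
  assumes "\<And>s t. 1 \<le> s \<Longrightarrow> s \<le> t \<Longrightarrow> b s \<le> b t" and "1 \<le> T"
  shows "card (explored (\<lambda>t. real (b t)) T) \<le> b T"
  using \<open>1 \<le> T\<close>
proof (induction T rule: dec_induct)
  case (step t)
  have "Suc t \<notin> explored (\<lambda>t. real (b t)) t" using explored_subset[of "\<lambda>t. real (b t)" t] by auto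
  with step assms(1)[of t "Suc t"] show ?case by auto
qed simp

lemma card_explored_le_real:
  assumes "\<And>s t. 1 \<le> s \<Longrightarrow> s \<le> t \<Longrightarrow> B s \<le> B t" and "\<And>t. 0 \<le> B t" and "1 \<le> T"
  shows "real (card (explored B T)) \<le> B T + 1"
  using \<open>1 \<le> T\<close>
proof (induction T rule: dec_induct)
  case (step t)
  have "Suc t \<notin> explored B t" using explored_subset[of B t] by auto
  with step assms(1)[of t "Suc t"] show ?case by auto
qed (use assms(2)[of 1] in simp)

text \<open>The running count of an exploration time is its rank among all of them. Since the round
  robin looks only at this rank, counting observations of an arm becomes counting integers in a
  residue class.\<close>

lemma bij_betw_card_explored: "bij_betw (\<lambda>s. card (explored B s)) (explored B t) {1..card (explored B t)}"
proof (induction t)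
  case (Suc t)
  have notin: "Suc t \<notin> explored B t" using explored_subset[of B t] by auto
  show ?case
  proof (cases "Suc t \<in> explored B (Suc t)")
    case True
    hence eq: "explored B (Suc t) = insert (Suc t) (explored B t)"
      using notin by (auto split: if_splits)
    have card: "card (explored B (Suc t)) = Suc (card (explored B t))"
      unfolding eq using notin by simp
    have "{1..card (explored B (Suc t))} = insert (card (explored B (Suc t))) {1..card (explored B t)}"
      unfolding card by auto
    moreover have "bij_betw (\<lambda>s. card (explored B s)) (explored B t \<union> {Suc t})
        ({1..card (explored B t)} \<union> {card (explored B (Suc t))})"
      by (rule notIn_Un_bij_betw[OF notin _ Suc.IH]) (use card in auto)
    ultimately show ?thesis unfolding eq by (simp del: explored.simps)
  next
    case False
    hence "explored B (Suc t) = explored B t" by (auto split: if_splits)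
    with Suc.IH show ?thesis by simp
  qed
qed (simp add: bij_betw_def)

lemma finite_obs_times [simp]: "finite (obs_times N B n t)"
  by (simp add: obs_times_def)

lemma obs_times_subset: "obs_times N B n t \<subseteq> {1..}"
  using explored_subset[of B t] by (auto simp: obs_times_def)

lemma card_obs_times:
  assumes "1 \<le> n"
  shows "card (obs_times N B n t) = card {k. k < card (explored B t) \<and> k mod N = n - 1}"
proof (rule bij_betw_same_card)
  have 1: "bij_betw (\<lambda>s. card (explored B s)) (obs_times N B n t)
      {k \<in> {1..card (explored B t)}. round_robin k N = n}"
    using bij_betw_card_explored[of B t]
    by (auto simp: bij_betw_def obs_times_def inj_on_def image_iff)
  have 2: "bij_betw (\<lambda>k. k - 1) {k \<in> {1..card (explored B t)}. round_robin k N = n}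
      {k. k < card (explored B t) \<and> k mod N = n - 1}"
    using assms by (intro bij_betwI[where g = Suc]) (auto simp: round_robin_def)
  show "bij_betw ((\<lambda>k. k - 1) \<circ> (\<lambda>s. card (explored B s))) (obs_times N B n t)
      {k. k < card (explored B t) \<and> k mod N = n - 1}"
    by (rule bij_betw_trans[OF 1 2])
qed

lemma card_residue_class:
  fixes r :: nat
  assumes "r < N"
  shows "card {k. k < N * L \<and> k mod N = r} = L"
proof -
  have "bij_betw (\<lambda>i. N * i + r) {..<L} {k. k < N * L \<and> k mod N = r}"
  proof (rule bij_betwI[where g = "\<lambda>k. k div N"])
    show "(\<lambda>i. N * i + r) \<in> {..<L} \<rightarrow> {k. k < N * L \<and> k mod N = r}"
    proof
      fix i assume "i \<in> {..<L}"
      hence "N * (i + 1) \<le> N * L" by (intro mult_le_mono2) auto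
      with assms show "N * i + r \<in> {k. k < N * L \<and> k mod N = r}" by auto
    qed
  qed (use assms in \<open>auto simp: div_less_iff_less_mult less_mult_imp_div_less mult.commute\<close>)
  thus ?thesis using bij_betw_same_card by fastforce
qed

lemma card_obs_times_le:
  assumes "n \<in> {1..N}" "card (explored B t) \<le> N * L"
  shows "card (obs_times N B n t) \<le> L"
proof -
  have "card {k. k < card (explored B t) \<and> k mod N = n - 1} \<le> card {k. k < N * L \<and> k mod N = n - 1}"
    using assms by (intro card_mono) auto
  moreover have "card {k. k < N * L \<and> k mod N = n - 1} = L"
    using assms by (intro card_residue_class) auto
  ultimately show ?thesis using assms by (simp add: card_obs_times)
qed

lemma le_card_obs_times:
  assumes "n \<in> {1..N}" "N * L \<le> card (explored B t)"
  shows "L \<le> card (obs_times N B n t)"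
proof -
  have "card {k. k < N * L \<and> k mod N = n - 1} \<le> card {k. k < card (explored B t) \<and> k mod N = n - 1}"
    using assms by (intro card_mono) auto
  moreover have "card {k. k < N * L \<and> k mod N = n - 1} = L"
    using assms by (intro card_residue_class) auto
  ultimately show ?thesis using assms by (simp add: card_obs_times)
qed

text \<open>For the power budgets of (iii), which need not be multiples of \<open>N\<close>:
  rounding down the equal share costs at most one observation.\<close>

lemma card_obs_times_ge_real:
  assumes "n \<in> {1..N}" "y \<le> real (card (explored B t))"
  shows "y / real N - 1 \<le> real (card (obs_times N B n t))"
proof -
  have N: "0 < real N" using assms by auto
  have "card (explored B t) div N \<le> card (obs_times N B n t)"
    by (intro le_card_obs_times assms) simp
  moreover have "real (card (explored B t)) / real N - 1 \<le> real (card (explored B t) div N)"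
    using floor_divide_of_nat_eq[of "card (explored B t)" N, where 'a = real]
      real_of_int_floor_gt_diff_one[of "real (card (explored B t)) / real N"] by simp
  moreover have "y / real N \<le> real (card (explored B t)) / real N"
    using assms N by (intro divide_right_mono) auto
  ultimately show ?thesis by linarith
qed

section \<open>The desired arm in a perturbed ordering\<close>

text \<open>Pigeonhole on true ranks. If \<open>\<rho>\<close> puts the desired arm in position
  \<open>k\<close>, then \<open>h\<close> sends positions before \<open>k\<close> injectively to
  ranks before \<open>m\<close>, and positions after \<open>k\<close> to ranks after
  \<open>m\<close>; counting both sides forces \<open>k = m\<close>. Strictness makes the way of
  breaking ties irrelevant.\<close>

lemma ranks_arms_eqI:
  assumes \<sigma>: "\<sigma> permutes {1..N}" and \<rho>: "ranks_arms N y \<rho>" and m: "m \<in> {1..N}"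
    and above: "\<And>j. j \<in> {1..N} \<Longrightarrow> j < m \<Longrightarrow> y (\<sigma> m) < y (\<sigma> j)"
    and below: "\<And>j. j \<in> {1..N} \<Longrightarrow> m < j \<Longrightarrow> y (\<sigma> j) < y (\<sigma> m)"
  shows "\<rho> m = \<sigma> m"
proof -
  have \<rho>p: "\<rho> permutes {1..N}" and \<rho>le: "\<And>i j. i \<in> {1..N} \<Longrightarrow> j \<in> {1..N} \<Longrightarrow> i \<le> j \<Longrightarrow> y (\<rho> j) \<le> y (\<rho> i)"
    using \<rho> by (auto simp: ranks_arms_def)
  define h where "h = inv \<sigma> \<circ> \<rho>"
  have h: "h permutes {1..N}"
    unfolding h_def by (intro permutes_compose \<rho>p permutes_inv \<sigma>)
  have \<sigma>h: "\<sigma> (h i) = \<rho> i" for i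
    using permutes_inverses(1)[OF \<sigma>] by (simp add: h_def)
  have h_in: "h i \<in> {1..N}" if "i \<in> {1..N}" for i
    using permutes_in_image[OF h] that by blast
  obtain k where k: "k \<in> {1..N}" "h k = m"
    using permutes_image[OF h] m by (metis imageE)
  have lt: "h i < m" if "i \<in> {1..N}" "i < k" for i
  proof -
    have "h i \<noteq> m" using permutes_inj[OF h] k that by (metis injD less_irrefl)
    moreover have "y (\<sigma> m) \<le> y (\<sigma> (h i))" using \<rho>le[of i k] that k \<sigma>h by fastforce
    ultimately show ?thesis using below[OF h_in[OF that(1)]] by force
  qed
  have gt: "m < h i" if "i \<in> {1..N}" "k < i" for i
  proof -
    have "h i \<noteq> m" using permutes_inj[OF h] k that by (metis injD less_irrefl)
    moreover have "y (\<sigma> (h i)) \<le> y (\<sigma> m)" using \<rho>le[of k i] that k \<sigma>h by fastforce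
    ultimately show ?thesis using above[OF h_in[OF that(1)]] by force
  qed
  have inj: "inj_on h A" for A using permutes_inj[OF h] by (rule inj_on_subset) simp
  have "card (h ` {1..<k}) \<le> card {1..<m}"
    by (intro card_mono) (use lt h_in k in \<open>auto simp: Suc_le_eq\<close>)
  hence "k - 1 \<le> m - 1" by (simp add: card_image[OF inj])
  hence "k \<le> m" using k m by auto
  have "card (h ` {k<..N}) \<le> card {m<..N}"
    by (intro card_mono) (use gt h_in k in auto)
  hence "N - k \<le> N - m" by (simp add: card_image[OF inj])
  hence "m \<le> k" using k m by auto
  with \<open>k \<le> m\<close> have "k = m" by simp
  thus ?thesis using \<sigma>h[of m] k by simp
qed

lemma ranks_arms_in_range:
  assumes "ranks_arms N x \<sigma>" "j \<in> {1..N}"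
  shows "\<sigma> j \<in> {1..N}"
proof -
  have "\<sigma> permutes {1..N}" using assms(1) by (simp add: ranks_arms_def)
  from permutes_in_image[OF this] show ?thesis using assms(2) by blast
qed

text \<open>Only the neighbours of rank \<open>m\<close> enter \<open>separation\<close>; all other
  arms are at least as far from the desired one because the means are sorted.\<close>

lemma separation_le:
  assumes \<sigma>: "ranks_arms N (arm_mean F) \<sigma>" and m: "m \<in> {1..N}" and j: "j \<in> {1..N}"
  shows "j < m \<Longrightarrow> separation N F \<sigma> m \<le> arm_mean F (\<sigma> j) - arm_mean F (\<sigma> m)"
    and "m < j \<Longrightarrow> separation N F \<sigma> m \<le> arm_mean F (\<sigma> m) - arm_mean F (\<sigma> j)"
proof -
  have mono: "arm_mean F (\<sigma> k) \<le> arm_mean F (\<sigma> i)" if "i \<in> {1..N}" "k \<in> {1..N}" "i \<le> k" for i k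
    using \<sigma> that by (auto simp: ranks_arms_def)
  have sep: "separation N F \<sigma> m \<le> arm_mean F (\<sigma> (i - 1)) - arm_mean F (\<sigma> i)"
    if "i \<in> {m, m + 1} \<inter> {2..N}" for i
    using that unfolding separation_def by (intro Min_le) (auto simp: gap_def image_iff)
  show "separation N F \<sigma> m \<le> arm_mean F (\<sigma> j) - arm_mean F (\<sigma> m)" if "j < m"
  proof -
    have "separation N F \<sigma> m \<le> arm_mean F (\<sigma> (m - 1)) - arm_mean F (\<sigma> m)"
      using that m j by (intro sep) auto
    moreover have "arm_mean F (\<sigma> (m - 1)) \<le> arm_mean F (\<sigma> j)"
      using that m j by (intro mono) auto
    ultimately show ?thesis by simp
  qed
  show "separation N F \<sigma> m \<le> arm_mean F (\<sigma> m) - arm_mean F (\<sigma> j)" if "m < j"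
  proof -
    have "separation N F \<sigma> m \<le> arm_mean F (\<sigma> (m + 1 - 1)) - arm_mean F (\<sigma> (m + 1))"
      using that m j by (intro sep) auto
    moreover have "arm_mean F (\<sigma> j) \<le> arm_mean F (\<sigma> (m + 1))"
      using that m j by (intro mono) auto
    ultimately show ?thesis by simp
  qed
qed

text \<open>The other arms may be tied or misordered among themselves; only the side of the desired
  arm on which each of them lies matters.\<close>

lemma exploitation_correct:
  assumes \<sigma>: "ranks_arms N (arm_mean F) \<sigma>" and m: "m \<in> {1..N}"
    and d: "2 * d < separation N F \<sigma> m"
    and close: "\<And>n. n \<in> {1..N} \<Longrightarrow> \<bar>y n - arm_mean F n\<bar> \<le> d"
    and \<rho>: "ranks_arms N y \<rho>"
  shows "\<rho> m = \<sigma> m"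
proof (rule ranks_arms_eqI[OF _ \<rho> m])
  show "\<sigma> permutes {1..N}" using \<sigma> by (simp add: ranks_arms_def)
  note in_range = ranks_arms_in_range[OF \<sigma>]
  fix j assume j: "j \<in> {1..N}"
  note c = close[OF in_range[OF j]] close[OF in_range[OF m]]
  show "y (\<sigma> m) < y (\<sigma> j)" if "j < m"
    using separation_le(1)[OF \<sigma> m j that] c d by linarith
  show "y (\<sigma> j) < y (\<sigma> m)" if "m < j"
    using separation_le(2)[OF \<sigma> m j that] c d by linarith
qed

section \<open>Regret decomposition\<close>

lemma Max_cost_pos:
  fixes C :: "nat \<Rightarrow> real"
  assumes N: "2 \<le> N" and C: "\<And>j. j \<in> {1..N} - {m} \<Longrightarrow> 0 < C j"
  shows "0 < Max (C ` ({1..N} - {m}))"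
proof -
  have "(if m = 1 then 2 else 1) \<in> {1..N} - {m}" using N by auto
  thus ?thesis using C by (subst Max_gr_iff) blast+
qed

text \<open>The statistic and its deviation bound are left abstract, so that all four parts can use
  this. The summand 1 is the first time step, an exploitation time without any observation, charged
  at the largest cost; the factor \<open>N\<close> comes from the union bound over the arms.\<close>

lemma (in prob_space) regret_le:
  assumes N: "2 \<le> N" and \<sigma>: "ranks_arms N (arm_mean F) \<sigma>" and m: "m \<in> {1..N}"
    and C: "\<And>j. j \<in> {1..N} - {m} \<Longrightarrow> 0 < C j"
    and \<pi>: "dsee_policy M N B m S \<pi>"
    and d: "2 * d < separation N F \<sigma> m"
    and S: "\<And>n t. n \<in> {1..N} \<Longrightarrow> S n t \<in> borel_measurable M"
    and b: "\<And>n t. n \<in> {1..N} \<Longrightarrow> 2 \<le> t \<Longrightarrow> t \<notin> explored B t \<Longrightarrow>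
      prob {\<omega>\<in>space M. d < \<bar>S n t \<omega> - arm_mean F n\<bar>} \<le> b t"
    and b_nonneg: "\<And>t. 0 \<le> b t"
    and T: "1 \<le> T"
  shows "regret M N \<sigma> C m \<pi> T \<le>
    (\<Sum>j\<in>{1..N} - {m}. real (card (obs_times N B (\<sigma> j) T)) * C j) +
    Max (C ` ({1..N} - {m})) * (1 + real N * (\<Sum>t=2..T. b t))"
proof -
  define J where "J = {1..N} - {m}"
  define c where "c = Max (C ` J)"
  define cost where "cost k = (\<Sum>j\<in>J. if k = \<sigma> j then C j else 0)" for k
  define bad where "bad n t = {\<omega>\<in>space M. d < \<bar>S n t \<omega> - arm_mean F n\<bar>}" for n t
  define play where "play t = round_robin (card (explored B t)) N" for t
  have perm: "\<sigma> permutes {1..N}" using \<sigma> by (simp add: ranks_arms_def)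
  have fin: "finite J" by (simp add: J_def)
  have Cpos: "0 < C j" if "j \<in> J" for j using C that by (simp add: J_def)
  have C_le: "C j \<le> c" if "j \<in> J" for j
    unfolding c_def using that fin by (intro Max_ge) auto
  have c: "0 < c" unfolding c_def J_def by (rule Max_cost_pos[OF N C])
  have cost_nonneg: "0 \<le> cost k" for k
    unfolding cost_def by (intro sum_nonneg) (auto intro: less_imp_le Cpos)
  \<comment> \<open>\<open>\<sigma>\<close> is injective, so at most one summand is nonzero.\<close>
  have cost_le: "cost k \<le> c" for k
  proof (cases "\<exists>i\<in>J. k = \<sigma> i")
    case True
    then obtain i where i: "i \<in> J" "k = \<sigma> i" by blast
    have "cost k = (\<Sum>j\<in>J. if j = i then C j else 0)"
      unfolding cost_def i(2) using permutes_inj[OF perm] by (intro sum.cong) (auto dest: injD)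
    also have "\<dots> = C i" using i fin by simp
    finally show ?thesis using C_le[OF i(1)] by simp
  next
    case False
    hence "cost k = 0" unfolding cost_def by (intro sum.neutral) auto
    with c show ?thesis by simp
  qed
  have cost_desired: "cost (\<sigma> m) = 0"
    unfolding cost_def using permutes_inj[OF perm] by (intro sum.neutral) (auto simp: J_def dest: injD)
  have [measurable]: "\<pi> t \<in> measurable M (count_space UNIV)" if "1 \<le> t" for t
    using \<pi> that by (auto simp: dsee_policy_def)
  have \<pi>_explore: "\<pi> t \<omega> = play t" if "1 \<le> t" "t \<in> explored B t" "\<omega> \<in> space M" for t \<omega>
    using \<pi> that unfolding dsee_policy_def play_def by (metis (no_types, lifting))
  have \<pi>_exploit: "\<exists>\<rho>. ranks_arms N (\<lambda>n. S n t \<omega>) \<rho> \<and> \<pi> t \<omega> = \<rho> m"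
    if "1 \<le> t" "t \<notin> explored B t" "\<omega> \<in> space M" for t \<omega>
    using \<pi> that unfolding dsee_policy_def by (metis (no_types, lifting))
  have int: "integrable M (\<lambda>\<omega>. cost (\<pi> t \<omega>))" if t: "1 \<le> t" for t
  proof (rule integrable_const_bound[where B = c])
    show "(\<lambda>\<omega>. cost (\<pi> t \<omega>)) \<in> borel_measurable M"
      using t by (intro measurable_compose[of "\<pi> t" M "count_space UNIV" cost]) auto
  qed (use cost_le cost_nonneg in auto)
  have exploit: "expectation (\<lambda>\<omega>. cost (\<pi> t \<omega>)) \<le> c * (real N * b t)"
    if t: "2 \<le> t" "t \<notin> explored B t" for t
  proof -
    have t1: "1 \<le> t" using t by simp
    have bad: "bad n t \<in> events" if "n \<in> {1..N}" for n
      using S[OF that, of t] unfolding bad_def by measurable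
    have bad': "(\<Union>n\<in>{1..N}. bad n t) \<in> events" using bad by auto
    have "expectation (\<lambda>\<omega>. cost (\<pi> t \<omega>)) \<le> expectation (\<lambda>\<omega>. c * indicator (\<Union>n\<in>{1..N}. bad n t) \<omega>)"
    proof (intro integral_mono int t1)
      show "integrable M (\<lambda>\<omega>. c * indicator (\<Union>n\<in>{1..N}. bad n t) \<omega> :: real)"
        using bad' by (intro integrable_mult_right integrable_real_indicator) (auto simp: emeasure_eq_measure)
      fix \<omega> assume \<omega>: "\<omega> \<in> space M"
      show "cost (\<pi> t \<omega>) \<le> c * indicator (\<Union>n\<in>{1..N}. bad n t) \<omega>"
      proof (cases "\<omega> \<in> (\<Union>n\<in>{1..N}. bad n t)")
        case False
        obtain \<rho> where \<rho>: "ranks_arms N (\<lambda>n. S n t \<omega>) \<rho>" "\<pi> t \<omega> = \<rho> m"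
          using \<pi>_exploit[OF t1 t(2) \<omega>] by blast
        have "\<rho> m = \<sigma> m"
          using False \<omega> by (intro exploitation_correct[OF \<sigma> m d _ \<rho>(1)]) (auto simp: bad_def not_less)
        with \<rho> cost_desired False show ?thesis by simp
      qed (use cost_le in auto)
    qed
    also have "\<dots> = c * prob (\<Union>n\<in>{1..N}. bad n t)"
      using bad' by simp
    also have "prob (\<Union>n\<in>{1..N}. bad n t) \<le> (\<Sum>n\<in>{1..N}. prob (bad n t))"
      using bad by (intro measure_UNION_le) auto
    also have "\<dots> \<le> (\<Sum>n\<in>{1..N}. b t)"
      unfolding bad_def using b t by (intro sum_mono) auto
    finally show ?thesis using c by (simp add: mult_left_mono)
  qed
  have "regret M N \<sigma> C m \<pi> T = expectation (\<lambda>\<omega>. \<Sum>t=1..T. cost (\<pi> t \<omega>))"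
    by (simp add: regret_def cost_def J_def)
  also have "\<dots> = (\<Sum>t=1..T. expectation (\<lambda>\<omega>. cost (\<pi> t \<omega>)))"
    using int by (intro Bochner_Integration.integral_sum) auto
  \<comment> \<open>Exploration times are charged the exploitation term as well; it is nonnegative,
    and the two sums become independent of each other.\<close>
  also have "\<dots> \<le> (\<Sum>t=1..T. (if t \<in> explored B T then cost (play t) else 0) +
      (if t = 1 then c else c * (real N * b t)))"
  proof (intro sum_mono)
    fix t assume t: "t \<in> {1..T}"
    hence t1: "1 \<le> t" by simp
    have rest: "0 \<le> (if t = 1 then c else c * (real N * b t))" using c b_nonneg by auto
    show "expectation (\<lambda>\<omega>. cost (\<pi> t \<omega>)) \<le> (if t \<in> explored B T then cost (play t) else 0) +
      (if t = 1 then c else c * (real N * b t))"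
    proof (cases "t \<in> explored B T")
      case True
      hence "t \<in> explored B t" using explored_iff_restrict[of t T B] t by simp
      hence "expectation (\<lambda>\<omega>. cost (\<pi> t \<omega>)) = expectation (\<lambda>\<omega>. cost (play t))"
        using \<pi>_explore[OF t1] by (intro Bochner_Integration.integral_cong) auto
      with True rest show ?thesis by (simp add: prob_space)
    next
      case False
      hence nt: "t \<notin> explored B t" using explored_iff_restrict[of t T B] t by simp
      show ?thesis
      proof (cases "t = 1")
        case True
        have "expectation (\<lambda>\<omega>. cost (\<pi> t \<omega>)) \<le> expectation (\<lambda>\<omega>. c)"
          by (intro integral_mono int t1 cost_le) auto
        with True False show ?thesis by (simp add: prob_space)
      next
        case t': False
        with exploit[OF _ nt] t1 False show ?thesis by simp
      qed
    qed
  qed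
  also have "\<dots> = (\<Sum>t\<in>explored B T. cost (play t)) + (c + (\<Sum>t=2..T. c * (real N * b t)))"
  proof -
    have "(\<Sum>t=1..T. if t \<in> explored B T then cost (play t) else 0) = (\<Sum>t\<in>{1..T} \<inter> explored B T. cost (play t))"
      by (rule sum.inter_restrict[symmetric]) simp
    also have "{1..T} \<inter> explored B T = explored B T" using explored_subset[of B T] by auto
    finally have 1: "(\<Sum>t=1..T. if t \<in> explored B T then cost (play t) else 0) = (\<Sum>t\<in>explored B T. cost (play t))" .
    have "(\<Sum>t=1..T. if t = 1 then c else c * (real N * b t))
        = c + (\<Sum>t=Suc 1..T. if t = 1 then c else c * (real N * b t))"
      using T by (subst sum.atLeast_Suc_atMost) auto
    also have "(\<Sum>t=Suc 1..T. if t = 1 then c else c * (real N * b t)) = (\<Sum>t=2..T. c * (real N * b t))"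
      by (intro sum.cong) auto
    finally show ?thesis unfolding sum.distrib 1 by simp
  qed
  also have "(\<Sum>t\<in>explored B T. cost (play t)) = (\<Sum>j\<in>J. \<Sum>t\<in>explored B T. if play t = \<sigma> j then C j else 0)"
    unfolding cost_def by (rule sum.swap)
  also have "\<dots> = (\<Sum>j\<in>J. real (card (obs_times N B (\<sigma> j) T)) * C j)"
  proof (intro sum.cong refl)
    fix j
    have "(\<Sum>t\<in>explored B T. if play t = \<sigma> j then C j else 0) = (\<Sum>t\<in>{t \<in> explored B T. play t = \<sigma> j}. C j)"
      by (rule sum.inter_filter[symmetric]) simp
    thus "(\<Sum>t\<in>explored B T. if play t = \<sigma> j then C j else 0) = real (card (obs_times N B (\<sigma> j) T)) * C j"
      by (simp add: obs_times_def play_def)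
  qed
  finally show ?thesis by (simp add: c_def J_def sum_distrib_left distrib_left)
qed

lemma regret_nonneg:
  assumes "\<And>j. j \<in> {1..N} - {m} \<Longrightarrow> 0 < C j"
  shows "0 \<le> regret M N \<sigma> C m \<pi> T"
  unfolding regret_def
  by (intro Bochner_Integration.integral_nonneg sum_nonneg) (auto intro!: less_imp_le[OF assms])

section \<open>Deviations of the arm statistics\<close>

context stochastic_bandit
begin

lemma reward_measurable [measurable]:
  "n \<in> {1..N} \<Longrightarrow> 1 \<le> t \<Longrightarrow> X n t \<in> borel_measurable M"
  using indep_rewards by (auto simp: indep_vars_def)

lemma reward_indep:
  assumes "n \<in> {1..N}" "inj_on f J" "f ` J \<subseteq> {1..}"
  shows "indep_vars (\<lambda>_. borel) (\<lambda>j. X n (f j)) J"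
proof -
  have "inj_on (\<lambda>j. (n, f j)) J" "(\<lambda>j. (n, f j)) ` J \<subseteq> {1..N} \<times> {1..}"
    using assms by (auto simp: inj_on_def)
  from indep_vars_reindex[OF indep_rewards this] show ?thesis by simp
qed

lemma
  fixes g :: "real \<Rightarrow> real"
  assumes "n \<in> {1..N}" "1 \<le> t" "g \<in> borel_measurable borel"
  shows integrable_reward_iff: "integrable M (\<lambda>\<omega>. g (X n t \<omega>)) \<longleftrightarrow> integrable (F n) g"
    and expectation_reward: "expectation (\<lambda>\<omega>. g (X n t \<omega>)) = (\<integral>x. g x \<partial>F n)"
proof -
  have X: "X n t \<in> borel_measurable M" by (rule reward_measurable[OF assms(1,2)])
  note F = reward_distr[OF assms(1,2)]
  show "integrable M (\<lambda>\<omega>. g (X n t \<omega>)) \<longleftrightarrow> integrable (F n) g"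
    using integrable_distr_eq[OF X assms(3)] unfolding F ..
  show "expectation (\<lambda>\<omega>. g (X n t \<omega>)) = (\<integral>x. g x \<partial>F n)"
    using integral_distr[OF X assms(3)] unfolding F ..
qed

lemma prob_space_arm: "n \<in> {1..N} \<Longrightarrow> prob_space (F n)"
  using reward_distr[of n 1] prob_space_distr[of "X n 1" borel] by auto

lemma sets_arm: "n \<in> {1..N} \<Longrightarrow> sets (F n) = sets borel"
  using reward_distr[of n 1] sets_distr[of M borel "X n 1"] by simp

lemma integrable_reward:
  assumes "n \<in> {1..N}" "1 \<le> t"
  shows "integrable M (X n t)"
proof -
  have "(\<lambda>x::real. x) \<in> borel_measurable borel" by simp
  from integrable_reward_iff[OF assms this] finite_mean[OF assms(1)] show ?thesis by simp
qed

lemma mean_reward: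
  assumes "n \<in> {1..N}" "1 \<le> t"
  shows "expectation (X n t) = arm_mean F n"
proof -
  have "(\<lambda>x::real. x) \<in> borel_measurable borel" by simp
  from expectation_reward[OF assms this] show ?thesis by (simp add: arm_mean_def)
qed

lemma deviation_le_centered_sum:
  assumes "finite A" "A \<noteq> {}" "A \<subseteq> {1..}" "n \<in> {1..N}"
  shows "prob {\<omega>\<in>space M. d < \<bar>(\<Sum>s\<in>A. X n s \<omega>) / real (card A) - arm_mean F n\<bar>}
    \<le> prob {\<omega>\<in>space M. d * real (card A) \<le> \<bar>\<Sum>s\<in>A. X n s \<omega> - arm_mean F n\<bar>}"
proof (intro finite_measure_mono subsetI CollectI conjI)
  have [measurable]: "X n s \<in> borel_measurable M" if "s \<in> A" for s
    using assms that by auto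
  show "{\<omega>\<in>space M. d * real (card A) \<le> \<bar>\<Sum>s\<in>A. X n s \<omega> - arm_mean F n\<bar>} \<in> events"
    by measurable
  fix \<omega> assume \<omega>: "\<omega> \<in> {\<omega>\<in>space M. d < \<bar>(\<Sum>s\<in>A. X n s \<omega>) / real (card A) - arm_mean F n\<bar>}"
  thus "\<omega> \<in> space M" by simp
  have card: "0 < real (card A)" using assms by (simp add: card_gt_0_iff)
  have "(\<Sum>s\<in>A. X n s \<omega> - arm_mean F n) = ((\<Sum>s\<in>A. X n s \<omega>) / real (card A) - arm_mean F n) * real (card A)"
    using card by (simp add: sum_subtractf field_simps)
  hence "\<bar>\<Sum>s\<in>A. X n s \<omega> - arm_mean F n\<bar> = \<bar>(\<Sum>s\<in>A. X n s \<omega>) / real (card A) - arm_mean F n\<bar> * real (card A)"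
    by (simp add: abs_mult)
  with \<omega> card show "d * real (card A) \<le> \<bar>\<Sum>s\<in>A. X n s \<omega> - arm_mean F n\<bar>" by simp
qed

text \<open>Independence and identical distribution turn the joint law into a power of
  \<open>F n\<close>, in which the enumeration \<open>h\<close> no longer appears.\<close>

lemma distr_reward_sum:
  fixes h :: "nat \<Rightarrow> nat"
  assumes n: "n \<in> {1..N}" and h: "inj_on h {1..k}" "h ` {1..k} \<subseteq> {1..}" and k: "1 \<le> k"
  shows "distr M borel (\<lambda>\<omega>. \<Sum>i=1..k. X n (h i) \<omega>) = distr (\<Pi>\<^sub>M i\<in>{1..k}. F n) borel (\<lambda>x. \<Sum>i=1..k. x i)"
proof -
  have meas: "X n (h i) \<in> borel_measurable M" if "i \<in> {1..k}" for i
    using h(2) that by (intro reward_measurable n) (auto simp: image_subset_iff)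
  have "distr M (\<Pi>\<^sub>M i\<in>{1..k}. borel) (\<lambda>\<omega>. \<lambda>i\<in>{1..k}. X n (h i) \<omega>) = (\<Pi>\<^sub>M i\<in>{1..k}. distr M borel (X n (h i)))"
    using k meas by (intro iffD1[OF indep_vars_iff_distr_eq_PiM' reward_indep[OF n h]]) auto
  also have "\<dots> = (\<Pi>\<^sub>M i\<in>{1..k}. F n)"
    using h by (intro PiM_cong refl reward_distr n) (auto simp: image_subset_iff)
  finally have eq: "distr M (\<Pi>\<^sub>M i\<in>{1..k}. borel) (\<lambda>\<omega>. \<lambda>i\<in>{1..k}. X n (h i) \<omega>) = (\<Pi>\<^sub>M i\<in>{1..k}. F n)" .
  have "distr (\<Pi>\<^sub>M i\<in>{1..k}. F n) borel (\<lambda>x. \<Sum>i=1..k. x i)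
      = distr M borel ((\<lambda>x. \<Sum>i=1..k. x i) \<circ> (\<lambda>\<omega>. \<lambda>i\<in>{1..k}. X n (h i) \<omega>))"
    unfolding eq[symmetric] using meas by (intro distr_distr) (auto intro!: measurable_restrict)
  also have "(\<lambda>x. \<Sum>i=1..k. x i) \<circ> (\<lambda>\<omega>. \<lambda>i\<in>{1..k}. X n (h i) \<omega>) = (\<lambda>\<omega>. \<Sum>i=1..k. X n (h i) \<omega>)"
    by (auto simp: fun_eq_iff)
  finally show ?thesis ..
qed

text \<open>The tail hypothesis of (i) concerns the first \<open>s\<close> rewards of an arm,
  whereas the policy averages rewards at scattered exploration times; equality of laws bridges the
  two.\<close>

lemma deviation_prob_times_irrelevant:
  assumes n: "n \<in> {1..N}" and A: "finite A" "A \<noteq> {}" "A \<subseteq> {1..}"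
  shows "prob {\<omega>\<in>space M. d \<le> \<bar>(\<Sum>s\<in>A. X n s \<omega>) / real (card A) - \<theta>\<bar>}
    = prob {\<omega>\<in>space M. d \<le> \<bar>(\<Sum>s=1..card A. X n s \<omega>) / real (card A) - \<theta>\<bar>}"
proof -
  define k where "k = card A"
  have k: "1 \<le> k" using A by (simp add: k_def Suc_le_eq card_gt_0_iff)
  obtain h where h: "bij_betw h {1..k} A"
    using A(1) unfolding k_def by (metis finite_atLeastAtMost bij_betw_iff_card card_atLeastAtMost diff_Suc_1)
  have sum_eq: "(\<Sum>s\<in>A. X n s \<omega>) = (\<Sum>i=1..k. X n (h i) \<omega>)" for \<omega>
    using sum.reindex_bij_betw[OF h, of "\<lambda>s. X n s \<omega>"] by simp
  define E where "E = {x :: real. d \<le> \<bar>x / real k - \<theta>\<bar>}"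
  have E: "E \<in> sets borel" unfolding E_def by measurable
  have prob_eq: "prob {\<omega>\<in>space M. d \<le> \<bar>(\<Sum>i=1..k. X n (h' i) \<omega>) / real k - \<theta>\<bar>}
      = measure (distr (\<Pi>\<^sub>M i\<in>{1..k}. F n) borel (\<lambda>x. \<Sum>i=1..k. x i)) E"
    if h': "inj_on h' {1..k}" "h' ` {1..k} \<subseteq> {1..}" for h'
  proof -
    have [measurable]: "X n (h' i) \<in> borel_measurable M" if "i \<in> {1..k}" for i
      using h'(2) that by (intro reward_measurable n) (auto simp: image_subset_iff)
    have "measure (distr M borel (\<lambda>\<omega>. \<Sum>i=1..k. X n (h' i) \<omega>)) E
        = prob ((\<lambda>\<omega>. \<Sum>i=1..k. X n (h' i) \<omega>) -` E \<inter> space M)"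
      using E by (intro measure_distr) auto
    also have "(\<lambda>\<omega>. \<Sum>i=1..k. X n (h' i) \<omega>) -` E \<inter> space M
        = {\<omega>\<in>space M. d \<le> \<bar>(\<Sum>i=1..k. X n (h' i) \<omega>) / real k - \<theta>\<bar>}"
      by (auto simp: E_def)
    finally show ?thesis using distr_reward_sum[OF n h' k] by simp
  qed
  have "h ` {1..k} \<subseteq> {1..}" "inj_on h {1..k}" using h A by (auto simp: bij_betw_def)
  from prob_eq[OF this(2,1)] prob_eq[of "\<lambda>i. i"] show ?thesis
    unfolding sum_eq k_def[symmetric] by simp
qed

lemma light_tailed_deviation:
  assumes n: "n \<in> {1..N}" and lt: "light_tailed (F n)" and d: "0 < d"
  shows "\<exists>r>0. \<forall>A. finite A \<longrightarrow> A \<subseteq> {1..} \<longrightarrow>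
    prob {\<omega>\<in>space M. d < \<bar>(\<Sum>s\<in>A. X n s \<omega>) / real (card A) - arm_mean F n\<bar>} \<le> 2 * exp (- r * real (card A))"
proof -
  interpret Fn: prob_space "F n" by (rule prob_space_arm[OF n])
  have [measurable_cong]: "sets (F n) = sets borel" by (rule sets_arm[OF n])
  define \<theta> where "\<theta> = arm_mean F n"
  obtain v where v: "0 < v" "\<And>u. \<bar>u\<bar> \<le> v \<Longrightarrow> integrable (F n) (\<lambda>x. exp (u * x))"
    using lt unfolding light_tailed_def by blast
  have exp_int: "integrable (F n) (\<lambda>x. exp (u * (x - \<theta>)))" if "\<bar>u\<bar> \<le> v" for u
  proof -
    have "integrable (F n) (\<lambda>x. exp (- (u * \<theta>)) * exp (u * x))"
      using v(2)[OF that] by simp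
    thus ?thesis by (simp add: mult_exp_exp algebra_simps)
  qed
  have "integrable (F n) (\<lambda>x. x - \<theta>)" "Fn.expectation (\<lambda>x. x - \<theta>) = 0"
    using finite_mean[OF n] by (simp_all add: \<theta>_def arm_mean_def Fn.prob_space)
  from Fn.expectation_exp_le_quadratic[OF this v(1)] exp_int[of v] exp_int[of "- v"] v(1)
  obtain K where K: "0 \<le> K" "\<And>u. \<bar>u\<bar> \<le> v / 2 \<Longrightarrow> integrable (F n) (\<lambda>x. exp (u * (x - \<theta>)))"
    "\<And>u. \<bar>u\<bar> \<le> v / 2 \<Longrightarrow> Fn.expectation (\<lambda>x. exp (u * (x - \<theta>))) \<le> exp (K * u\<^sup>2)"
    by auto
  \<comment> \<open>\<open>v / 2\<close> is the range of the quadratic bound. The other term is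
    close to the minimizer \<open>d / (2 * K)\<close> of the Chernoff exponent, with
    \<open>K + 1\<close> excluding a zero denominator; it lets the quadratic term use at most half
    of the gain \<open>u * d\<close>.\<close>
  define u where "u = min (v / 2) (d / (2 * (K + 1)))"
  have u: "0 < u" using v(1) d K(1) by (simp add: u_def)
  have u_le: "u \<le> v / 2" "u \<le> d / (2 * (K + 1))" unfolding u_def by (rule min.cobounded1, rule min.cobounded2)
  have Ku: "K * u\<^sup>2 \<le> u * d / 2"
  proof -
    have "K * u \<le> (K + 1) * u" using u by simp
    also have "\<dots> \<le> d / 2" using u_le(2) K(1) by (simp add: field_simps)
    finally show ?thesis using u by (simp add: power2_eq_square)
  qed
  show ?thesis
  proof (intro exI[of _ "u * d / 2"] conjI allI impI)
    show "0 < u * d / 2" using u d by simp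
    fix A :: "nat set" assume A: "finite A" "A \<subseteq> {1..}"
    show "prob {\<omega>\<in>space M. d < \<bar>(\<Sum>s\<in>A. X n s \<omega>) / real (card A) - arm_mean F n\<bar>}
        \<le> 2 * exp (- (u * d / 2) * real (card A))"
    proof (cases "A = {}")
      \<comment> \<open>Without observations the claimed bound is 2, so the default value of the
        mean does not matter.\<close>
      case True
      have "prob E \<le> 2" for E using prob_le_1[of E] by linarith
      with True show ?thesis by simp
    next
      case False
      have "prob {\<omega>\<in>space M. d < \<bar>(\<Sum>s\<in>A. X n s \<omega>) / real (card A) - arm_mean F n\<bar>}
          \<le> prob {\<omega>\<in>space M. d * real (card A) \<le> \<bar>\<Sum>s\<in>A. X n s \<omega> - \<theta>\<bar>}"
        unfolding \<theta>_def by (rule deviation_le_centered_sum[OF A(1) False A(2) n])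
      also have "\<dots> = prob {\<omega>\<in>space M. u * d * real (card A) \<le> \<bar>\<Sum>s\<in>A. u * (X n s \<omega> - \<theta>)\<bar>}"
        using u by (simp add: sum_distrib_left[symmetric] abs_mult mult.assoc)
      also have "\<dots> \<le> 2 * exp ((\<Sum>s\<in>A. K * u\<^sup>2) - u * d * real (card A))"
      proof (rule exponential_abs_tail_bound[OF A(1)])
        show "indep_vars (\<lambda>_. borel) (\<lambda>s \<omega>. u * (X n s \<omega> - \<theta>)) A"
          using reward_indep[OF n, of "\<lambda>s. s" A] A(2)
          by (intro indep_vars_compose2[where Y = "\<lambda>_ x. u * (x - \<theta>)"]) auto
        fix s and c :: real assume s: "s \<in> A" and c: "\<bar>c\<bar> = 1"
        have cu: "\<bar>c * u\<bar> \<le> v / 2" "(c * u)\<^sup>2 = u\<^sup>2"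
          using u u_le(1) c power2_abs[of c] by (auto simp: abs_mult power_mult_distrib simp del: power2_abs)
        have s1: "1 \<le> s" using A s by auto
        show "integrable M (\<lambda>\<omega>. exp (c * (u * (X n s \<omega> - \<theta>))))"
          using integrable_reward_iff[OF n s1, of "\<lambda>x. exp (c * (u * (x - \<theta>)))"] K(2)[OF cu(1)]
          by (simp add: mult.assoc)
        show "expectation (\<lambda>\<omega>. exp (c * (u * (X n s \<omega> - \<theta>)))) \<le> exp (K * u\<^sup>2)"
          using expectation_reward[OF n s1, of "\<lambda>x. exp (c * (u * (x - \<theta>)))"] K(3)[OF cu(1)] cu(2)
          by (simp add: mult.assoc)
      qed
      also have "\<dots> \<le> 2 * exp (- (u * d / 2) * real (card A))"
      proof -
        have "K * u\<^sup>2 * real (card A) \<le> u * d / 2 * real (card A)"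
          using Ku by (intro mult_right_mono) auto
        thus ?thesis by (simp add: mult_ac)
      qed
      finally show ?thesis .
    qed
  qed
qed

lemma finite_moment_deviation:
  assumes p: "1 < p" and mom: "\<And>n. n \<in> {1..N} \<Longrightarrow> integrable (F n) (\<lambda>x. \<bar>x\<bar> powr p)" and d: "0 < d"
  shows "\<exists>K\<ge>0. \<forall>n\<in>{1..N}. \<forall>A. finite A \<longrightarrow> A \<noteq> {} \<longrightarrow> A \<subseteq> {1..} \<longrightarrow>
    prob {\<omega>\<in>space M. d < \<bar>(\<Sum>s\<in>A. X n s \<omega>) / real (card A) - arm_mean F n\<bar>}
      \<le> K * real (card A) powr (max 1 (p / 2) - p)"
proof -
  define \<theta> where "\<theta> = arm_mean F"
  \<comment> \<open>The sum over the arms is one moment bound valid for all of them, hence a single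
    constant \<open>K\<close>.\<close>
  define u where "u = (\<Sum>n=1..N. \<integral>x. \<bar>x - \<theta> n\<bar> powr p \<partial>F n)"
  have u0: "0 \<le> u" unfolding u_def by (intro sum_nonneg Bochner_Integration.integral_nonneg) auto
  have centered: "integrable (F n) (\<lambda>x. \<bar>x - \<theta> n\<bar> powr p)" "(\<integral>x. \<bar>x - \<theta> n\<bar> powr p \<partial>F n) \<le> u"
    if n: "n \<in> {1..N}" for n
  proof -
    interpret Fn: prob_space "F n" by (rule prob_space_arm[OF n])
    have [measurable_cong]: "sets (F n) = sets borel" by (rule sets_arm[OF n])
    show "integrable (F n) (\<lambda>x. \<bar>x - \<theta> n\<bar> powr p)"
    proof (rule Bochner_Integration.integrable_bound)
      show "integrable (F n) (\<lambda>x. 2 powr p * (\<bar>x\<bar> powr p + \<bar>\<theta> n\<bar> powr p))"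
        using mom[OF n] by simp
      show "AE x in F n. norm (\<bar>x - \<theta> n\<bar> powr p) \<le> norm (2 powr p * (\<bar>x\<bar> powr p + \<bar>\<theta> n\<bar> powr p))"
      proof (rule AE_I2)
        fix x
        have "\<bar>x - \<theta> n\<bar> powr p \<le> (2 * max \<bar>x\<bar> \<bar>\<theta> n\<bar>) powr p"
          using p by (intro powr_mono2) auto
        also have "\<dots> = 2 powr p * max \<bar>x\<bar> \<bar>\<theta> n\<bar> powr p" by (simp add: powr_mult)
        also have "max \<bar>x\<bar> \<bar>\<theta> n\<bar> powr p \<le> \<bar>x\<bar> powr p + \<bar>\<theta> n\<bar> powr p" by (simp add: max_def)
        finally show "norm (\<bar>x - \<theta> n\<bar> powr p) \<le> norm (2 powr p * (\<bar>x\<bar> powr p + \<bar>\<theta> n\<bar> powr p))"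
          by simp
      qed
    qed measurable
    show "(\<integral>x. \<bar>x - \<theta> n\<bar> powr p \<partial>F n) \<le> u"
      unfolding u_def using n by (intro member_le_sum[where f = "\<lambda>n. \<integral>x. \<bar>x - \<theta> n\<bar> powr p \<partial>F n"]) auto
  qed
  obtain K where K: "0 \<le> K" "\<And>(Y :: nat \<Rightarrow> 'a \<Rightarrow> real) I. finite I \<Longrightarrow> indep_vars (\<lambda>_. borel) Y I \<Longrightarrow>
    (\<forall>i\<in>I. integrable M (Y i) \<and> expectation (Y i) = 0 \<and>
       integrable M (\<lambda>\<omega>. \<bar>Y i \<omega>\<bar> powr p) \<and> expectation (\<lambda>\<omega>. \<bar>Y i \<omega>\<bar> powr p) \<le> u) \<Longrightarrow>
    integrable M (\<lambda>\<omega>. \<bar>\<Sum>i\<in>I. Y i \<omega>\<bar> powr p) \<and>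
    expectation (\<lambda>\<omega>. \<bar>\<Sum>i\<in>I. Y i \<omega>\<bar> powr p) \<le> K * real (card I) powr (max 1 (p / 2))"
    using moment_sum_bound[OF p u0, where 'i = nat] by blast
  show ?thesis
  proof (intro exI[of _ "K / d powr p"] conjI ballI allI impI)
    show "0 \<le> K / d powr p" using K by simp
    fix n and A :: "nat set" assume n: "n \<in> {1..N}" and A: "finite A" "A \<noteq> {}" "A \<subseteq> {1..}"
    define k where "k = real (card A)"
    have k: "0 < k" using A by (simp add: k_def card_gt_0_iff)
    have "integrable M (\<lambda>\<omega>. X n s \<omega> - \<theta> n)" "expectation (\<lambda>\<omega>. X n s \<omega> - \<theta> n) = 0"
      "integrable M (\<lambda>\<omega>. \<bar>X n s \<omega> - \<theta> n\<bar> powr p)"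
      "expectation (\<lambda>\<omega>. \<bar>X n s \<omega> - \<theta> n\<bar> powr p) \<le> u" if "s \<in> A" for s
      using integrable_reward[OF n, of s] mean_reward[OF n, of s] that A centered[OF n]
        integrable_reward_iff[OF n, of s "\<lambda>x. \<bar>x - \<theta> n\<bar> powr p"]
        expectation_reward[OF n, of s "\<lambda>x. \<bar>x - \<theta> n\<bar> powr p"]
      by (auto simp: prob_space \<theta>_def)
    moreover have "indep_vars (\<lambda>_. borel) (\<lambda>s \<omega>. X n s \<omega> - \<theta> n) A"
      using reward_indep[OF n, of "\<lambda>s. s" A] A(3)
      by (intro indep_vars_compose2[where Y = "\<lambda>_ x. x - \<theta> n"]) auto
    ultimately have moment: "integrable M (\<lambda>\<omega>. \<bar>\<Sum>s\<in>A. X n s \<omega> - \<theta> n\<bar> powr p)"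
      "expectation (\<lambda>\<omega>. \<bar>\<Sum>s\<in>A. X n s \<omega> - \<theta> n\<bar> powr p) \<le> K * k powr (max 1 (p / 2))"
      using K(2)[OF A(1), of "\<lambda>s \<omega>. X n s \<omega> - \<theta> n"] by (auto simp: k_def)
    have "prob {\<omega>\<in>space M. d < \<bar>(\<Sum>s\<in>A. X n s \<omega>) / real (card A) - arm_mean F n\<bar>}
        \<le> prob {\<omega>\<in>space M. d * k \<le> \<bar>\<Sum>s\<in>A. X n s \<omega> - \<theta> n\<bar>}"
      unfolding \<theta>_def k_def by (rule deviation_le_centered_sum[OF A n])
    also have "\<dots> \<le> prob {\<omega>\<in>space M. (d * k) powr p \<le> \<bar>\<Sum>s\<in>A. X n s \<omega> - \<theta> n\<bar> powr p}"
    proof (intro finite_measure_mono)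
      have [measurable]: "X n s \<in> borel_measurable M" if "s \<in> A" for s
        using A n that by auto
      show "{\<omega>\<in>space M. (d * k) powr p \<le> \<bar>\<Sum>s\<in>A. X n s \<omega> - \<theta> n\<bar> powr p} \<in> events"
        by measurable
    qed (use d k p in \<open>auto intro!: powr_mono2\<close>)
    also have "\<dots> \<le> expectation (\<lambda>\<omega>. \<bar>\<Sum>s\<in>A. X n s \<omega> - \<theta> n\<bar> powr p) / (d * k) powr p"
      using d k by (intro integral_Markov_inequality_measure[OF moment(1), where A = "space M"]) auto
    also have "\<dots> \<le> K * k powr (max 1 (p / 2)) / (d * k) powr p"
      by (intro divide_right_mono moment) auto
    also have "\<dots> = K / d powr p * k powr (max 1 (p / 2) - p)"
      using d k by (simp add: powr_mult powr_diff)
    finally show "prob {\<omega>\<in>space M. d < \<bar>(\<Sum>s\<in>A. X n s \<omega>) / real (card A) - arm_mean F n\<bar>}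
      \<le> K / d powr p * real (card A) powr (max 1 (p / 2) - p)" by (simp add: k_def)
  qed
qed

lemma truncated_mean_deviation:
  assumes n: "n \<in> {1..N}" and p: "1 < p" "p \<le> 2" and u: "0 < u"
    and mom: "integrable (F n) (\<lambda>x. \<bar>x\<bar> powr p)" "(\<integral>x. \<bar>x\<bar> powr p \<partial>F n) \<le> u"
    and a: "a = 4 powr (p / (1 - p)) * u powr (1 / (1 - p))" and \<delta>: "0 < \<delta>"
    and \<tau>: "1 \<le> card (obs_times N B n (t - 1))"
  shows "prob {\<omega>\<in>space M. \<delta> < \<bar>truncated_mean u p a \<delta> X N B n t \<omega> - arm_mean F n\<bar>}
    \<le> 2 * exp (- (a * \<delta> powr (p / (p - 1))) * real (card (obs_times N B n (t - 1))))"
proof -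
  define A where "A = obs_times N B n (t - 1)"
  define l where "l = sorted_list_of_set A"
  define \<eta> where "\<eta> = a * \<delta> powr (p / (p - 1))"
  have a0: "0 < a" using u by (simp add: a)
  have \<eta>: "0 < \<eta>" using a0 \<delta> by (simp add: \<eta>_def)
  have l: "length l = card A" "set l = A" "distinct l" by (auto simp: l_def A_def)
  have times: "l ! (k - 1) \<in> {1..}" if "k \<in> {1..card A}" for k
  proof -
    have "k - 1 < length l" using that l by auto
    hence "l ! (k - 1) \<in> A" using l nth_mem by blast
    thus ?thesis using obs_times_subset[of N B n "t - 1"] unfolding A_def by blast
  qed
  have inj: "inj_on (\<lambda>k. l ! (k - 1)) {1..card A}"
  proof (rule inj_onI)
    fix i j assume *: "i \<in> {1..card A}" "j \<in> {1..card A}" "l ! (i - 1) = l ! (j - 1)"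
    hence "i - 1 < length l" "j - 1 < length l" using l by auto
    with * have "i - 1 = j - 1" using nth_eq_iff_index_eq[OF l(3)] by blast
    with * show "i = j" by auto
  qed
  \<comment> \<open>This equation determines \<open>a\<close>: it is the constant for which the
    deviation level of \<open>truncated_mean_tail_bound\<close> equals
    \<open>\<delta>\<close>.\<close>
  have delta: "4 * (u powr (1 / p) * \<eta> powr ((p - 1) / p)) = \<delta>"
  proof -
    have "\<eta> powr ((p - 1) / p) = a powr ((p - 1) / p) * \<delta>"
      using p \<delta> a0 by (simp add: \<eta>_def powr_mult powr_powr)
    also have "a powr ((p - 1) / p) = 4 powr (p / (1 - p) * ((p - 1) / p)) * u powr (1 / (1 - p) * ((p - 1) / p))"
      using u by (simp add: a powr_mult powr_powr)
    also have "p / (1 - p) * ((p - 1) / p) = - 1"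
      using p by (simp add: divide_simps)
    also have "1 / (1 - p) * ((p - 1) / p) = - (1 / p)"
      using p by (simp add: divide_simps)
    finally have "\<eta> powr ((p - 1) / p) = \<delta> / (4 * u powr (1 / p))"
      using u by (simp add: powr_minus field_simps)
    thus ?thesis using u by simp
  qed
  define Y where "Y k = X n (l ! (k - 1))" for k
  have "prob {\<omega>\<in>space M. 4 * (u powr (1 / p) * \<eta> powr ((p - 1) / p)) <
      \<bar>(\<Sum>k=1..card A. if \<bar>Y k \<omega>\<bar> \<le> (u * real k / (\<eta> * real (card A))) powr (1 / p) then Y k \<omega> else 0)
        / real (card A) - arm_mean F n\<bar>} \<le> 2 * exp (- \<eta> * real (card A))"
  proof (rule truncated_mean_tail_bound)
    show "1 \<le> card A" using \<tau> by (simp add: A_def)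
    show "indep_vars (\<lambda>_. borel) Y {1..card A}"
      unfolding Y_def using times by (intro reward_indep n inj) blast
    fix k assume k: "k \<in> {1..card A}"
    have t1: "1 \<le> l ! (k - 1)" using times[OF k] by simp
    show "integrable M (Y k)" "expectation (Y k) = arm_mean F n"
      unfolding Y_def using integrable_reward[OF n t1] mean_reward[OF n t1] by auto
    show "integrable M (\<lambda>\<omega>. \<bar>Y k \<omega>\<bar> powr p)" "expectation (\<lambda>\<omega>. \<bar>Y k \<omega>\<bar> powr p) \<le> u"
      unfolding Y_def using mom integrable_reward_iff[OF n t1, of "\<lambda>x. \<bar>x\<bar> powr p"]
        expectation_reward[OF n t1, of "\<lambda>x. \<bar>x\<bar> powr p"] by auto
  qed (use p u \<eta> in auto)
  moreover have obs: "observation X N B n t k \<omega> = Y k \<omega>" for k \<omega>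
    by (simp add: observation_def Y_def l_def A_def)
  \<comment> \<open>Here \<open>ln (inverse \<epsilon>)\<close> is \<open>\<eta>\<close> times the
    number of observations, so the policy's truncation levels are those of the tail bound.\<close>
  have "truncated_mean u p a \<delta> X N B n t \<omega> =
      (\<Sum>k=1..card A. if \<bar>Y k \<omega>\<bar> \<le> (u * real k / (\<eta> * real (card A))) powr (1 / p) then Y k \<omega> else 0)
        / real (card A)" for \<omega>
    unfolding truncated_mean_def Let_def obs by (simp add: A_def \<eta>_def exp_minus[symmetric])
  ultimately show ?thesis unfolding delta by (simp add: A_def \<eta>_def)
qed

lemma sample_mean_measurable:
  assumes "n \<in> {1..N}"
  shows "sample_mean X N B n t \<in> borel_measurable M"
proof -
  have [measurable]: "X n s \<in> borel_measurable M" if "s \<in> obs_times N B n (t - 1)" for s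
    using obs_times_subset that assms by fastforce
  show ?thesis unfolding sample_mean_def[abs_def] by measurable
qed

lemma truncated_mean_measurable:
  assumes "n \<in> {1..N}"
  shows "truncated_mean u p a \<delta> X N B n t \<in> borel_measurable M"
proof -
  have [measurable]: "observation X N B n t k \<in> borel_measurable M"
    if "k \<in> {1..card (obs_times N B n (t - 1))}" for k
  proof -
    have "sorted_list_of_set (obs_times N B n (t - 1)) ! (k - 1) \<in> obs_times N B n (t - 1)"
      using that nth_mem[of "k - 1" "sorted_list_of_set (obs_times N B n (t - 1))"] by auto
    with obs_times_subset have "1 \<le> sorted_list_of_set (obs_times N B n (t - 1)) ! (k - 1)" by fastforce
    with assms show ?thesis unfolding observation_def[abs_def] by (intro reward_measurable)
  qed
  show ?thesis unfolding truncated_mean_def[abs_def] Let_def by measurable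
qed

end

section \<open>Regret bounds\<close>

text \<open>A budget that is a multiple of \<open>N\<close> gives every arm the same share, so the
  upper bound that controls the exploration cost and the lower bound that controls the deviations
  are the same ceiling.\<close>

lemma
  assumes mono: "\<And>s t. 1 \<le> s \<Longrightarrow> s \<le> t \<Longrightarrow> g s \<le> g t" and nonneg: "\<And>t. 0 \<le> g t"
    and B: "B = (\<lambda>t. real N * real_of_int \<lceil>g t\<rceil>)" and n: "n \<in> {1..N}"
  shows card_obs_times_le_ceiling: "1 \<le> T \<Longrightarrow> real (card (obs_times N B n T)) \<le> real_of_int \<lceil>g T\<rceil>"
    and ceiling_le_card_obs_times: "2 \<le> t \<Longrightarrow> t \<notin> explored B t \<Longrightarrow>
      real_of_int \<lceil>g t\<rceil> \<le> real (card (obs_times N B n (t - 1)))"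
proof -
  define L where "L t = nat \<lceil>g t\<rceil>" for t
  have L: "real (L t) = real_of_int \<lceil>g t\<rceil>" for t
    using nonneg[of t] by (simp add: L_def ceiling_mono[of 0, simplified])
  have B': "B = (\<lambda>t. real (N * L t))" by (simp add: B L)
  show "real (card (obs_times N B n T)) \<le> real_of_int \<lceil>g T\<rceil>" if "1 \<le> T"
  proof -
    have "card (explored B T) \<le> N * L T"
      unfolding B' using that mono by (intro card_explored_le_nat) (auto simp: L_def intro!: nat_mono ceiling_mono)
    from card_obs_times_le[OF n this] show ?thesis unfolding L[symmetric] by simp
  qed
  show "real_of_int \<lceil>g t\<rceil> \<le> real (card (obs_times N B n (t - 1)))" if "2 \<le> t" "t \<notin> explored B t"
  proof -
    have "real (N * L t) \<le> real (card (explored B (t - 1)))"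
      using budget_le_card_explored[OF that] by (simp add: B')
    hence "N * L t \<le> card (explored B (t - 1))" by (simp only: of_nat_le_iff)
    from le_card_obs_times[OF n this] show ?thesis unfolding L[symmetric] by simp
  qed
qed

text \<open>Common to (i) and (iv), with \<open>r\<close> the rate of the tail bound. At least
  \<open>w * ln t\<close> observations turn the rate into the power \<open>t powr - (r * w)\<close>,
  which is summable precisely because \<open>1 / r < w\<close>.\<close>

lemma (in prob_space) regret_le_logarithmic:
  assumes N: "2 \<le> N" and \<sigma>: "ranks_arms N (arm_mean F) \<sigma>" and m: "m \<in> {1..N}"
    and C: "\<And>j. j \<in> {1..N} - {m} \<Longrightarrow> 0 < C j"
    and B: "B = (\<lambda>t. real N * real_of_int \<lceil>w * ln (real t)\<rceil>)"
    and \<pi>: "dsee_policy M N B m S \<pi>"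
    and d: "2 * d < separation N F \<sigma> m"
    and S: "\<And>n t. n \<in> {1..N} \<Longrightarrow> S n t \<in> borel_measurable M"
    and tail: "\<And>n t. n \<in> {1..N} \<Longrightarrow> 1 \<le> card (obs_times N B n (t - 1)) \<Longrightarrow>
      prob {\<omega>\<in>space M. d < \<bar>S n t \<omega> - arm_mean F n\<bar>}
        \<le> 2 * exp (- r * real (card (obs_times N B n (t - 1))))"
    and r: "0 < r" "1 / r < w"
    and T: "1 \<le> T"
  shows "regret M N \<sigma> C m \<pi> T \<le>
      (\<Sum>j\<in>{1..N} - {m}. real_of_int \<lceil>w * ln (real T)\<rceil> * C j) +
      2 * real N * Max (C ` ({1..N} - {m})) * (1 + 1 / (r * w - 1)) \<and>
    ((\<Sum>j\<in>{1..N} - {m}. C j) \<le> (\<Sum>n=2..N. gap F \<sigma> n) \<and>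
      Max (C ` ({1..N} - {m})) \<le> gap F \<sigma> N \<longrightarrow>
      regret M N \<sigma> C m \<pi> T \<le>
      (\<Sum>n=2..N. real_of_int \<lceil>w * ln (real T)\<rceil> * gap F \<sigma> n) +
      2 * real N * gap F \<sigma> N * (1 + 1 / (r * w - 1)))"
proof -
  define c where "c = Max (C ` ({1..N} - {m}))"
  define l where "l = real_of_int \<lceil>w * ln (real T)\<rceil>"
  have rw: "1 < r * w" using r by (simp add: field_simps)
  have w: "0 < w" using r by (meson less_trans zero_less_divide_1_iff)
  have mono: "w * ln (real s) \<le> w * ln (real t)" if "1 \<le> s" "s \<le> t" for s t :: nat
    using w that by simp
  have nonneg: "0 \<le> w * ln (real t)" for t
    using w by (cases "t = 0") auto
  have l: "0 \<le> l" using nonneg[of T] by (simp add: l_def ceiling_mono[of 0, simplified])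
  have in_range: "\<sigma> j \<in> {1..N}" if "j \<in> {1..N}" for j
    by (rule ranks_arms_in_range[OF \<sigma> that])
  have c: "0 < c" unfolding c_def by (rule Max_cost_pos[OF N C])
  have "regret M N \<sigma> C m \<pi> T \<le> (\<Sum>j\<in>{1..N} - {m}. real (card (obs_times N B (\<sigma> j) T)) * C j) +
      c * (1 + real N * (\<Sum>t=2..T. 2 * real t powr - (r * w)))"
    unfolding c_def
  proof (rule regret_le[OF N \<sigma> m C \<pi> d S _ _ T])
    fix n t assume n: "n \<in> {1..N}" and t: "2 \<le> t" "t \<notin> explored B t"
    define k where "k = real (card (obs_times N B n (t - 1)))"
    have "w * ln (real t) \<le> k"
      unfolding k_def
      by (rule order_trans[OF le_of_int_ceiling ceiling_le_card_obs_times[OF mono nonneg B n t]])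
    \<comment> \<open>Positivity at \<open>t \<ge> 2\<close> forces at least one observation, as the
      tail hypothesis demands.\<close>
    moreover have "0 < w * ln (real t)" using w t by simp
    ultimately have k: "1 \<le> card (obs_times N B n (t - 1))" "r * (w * ln (real t)) \<le> r * k"
      using r by (auto simp: k_def)
    have "prob {\<omega>\<in>space M. d < \<bar>S n t \<omega> - arm_mean F n\<bar>} \<le> 2 * exp (- r * k)"
      unfolding k_def by (rule tail[OF n k(1)])
    also have "\<dots> \<le> 2 * exp (- (r * w * ln (real t)))" using k(2) by (simp add: mult.assoc)
    also have "\<dots> = 2 * real t powr - (r * w)" using t by (simp add: powr_def)
    finally show "prob {\<omega>\<in>space M. d < \<bar>S n t \<omega> - arm_mean F n\<bar>} \<le> 2 * real t powr - (r * w)" .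
  qed auto
  also have "(\<Sum>j\<in>{1..N} - {m}. real (card (obs_times N B (\<sigma> j) T)) * C j) \<le> (\<Sum>j\<in>{1..N} - {m}. l * C j)"
    unfolding l_def using in_range C
    by (intro sum_mono mult_right_mono card_obs_times_le_ceiling[OF mono nonneg B _ T]) (auto intro: less_imp_le)
  also have "c * (1 + real N * (\<Sum>t=2..T. 2 * real t powr - (r * w))) \<le> c * (2 * real N * (1 + 1 / (r * w - 1)))"
  proof (intro mult_left_mono)
    have "real N * (\<Sum>t=2..T. 2 * real t powr - (r * w)) \<le> 2 * real N * (1 / (r * w - 1))"
    proof -
      have "2 * real N * (\<Sum>t=2..T. real t powr - (r * w)) \<le> 2 * real N * (1 / (r * w - 1))"
        by (intro mult_left_mono sum_powr_minus_le[OF rw]) auto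
      thus ?thesis by (simp only: sum_distrib_left[symmetric] mult_ac)
    qed
    \<comment> \<open>The cost of the first time step is absorbed by the summand 1 of the last
      factor.\<close>
    moreover have "1 \<le> 2 * real N" using N by simp
    ultimately show "1 + real N * (\<Sum>t=2..T. 2 * real t powr - (r * w)) \<le> 2 * real N * (1 + 1 / (r * w - 1))"
      by (simp add: distrib_left)
  qed (use c in auto)
  finally have main: "regret M N \<sigma> C m \<pi> T \<le>
      (\<Sum>j\<in>{1..N} - {m}. l * C j) + 2 * real N * c * (1 + 1 / (r * w - 1))"
    by (simp add: mult_ac)
  \<comment> \<open>The ceiling is the same for all arms, so comparing the sum of the costs with the
    sum of the gaps suffices; no comparison arm by arm is needed.\<close>
  moreover have "regret M N \<sigma> C m \<pi> T \<le>
      (\<Sum>n=2..N. l * gap F \<sigma> n) + 2 * real N * gap F \<sigma> N * (1 + 1 / (r * w - 1))"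
    if "(\<Sum>j\<in>{1..N} - {m}. C j) \<le> (\<Sum>n=2..N. gap F \<sigma> n)" "c \<le> gap F \<sigma> N"
  proof -
    have "l * (\<Sum>j\<in>{1..N} - {m}. C j) \<le> l * (\<Sum>n=2..N. gap F \<sigma> n)"
      using that(1) l by (rule mult_left_mono)
    moreover have "2 * real N * c * (1 + 1 / (r * w - 1)) \<le> 2 * real N * gap F \<sigma> N * (1 + 1 / (r * w - 1))"
      using that(2) rw by (intro mult_right_mono mult_left_mono) auto
    ultimately show ?thesis using main by (simp add: sum_distrib_left)
  qed
  ultimately show ?thesis unfolding l_def c_def by blast
qed

lemma (in stochastic_bandit) regret_light_tailed:
  assumes \<sigma>: "ranks_arms N (arm_mean F) \<sigma>" and m: "m \<in> {1..N}"
    and C: "\<And>j. j \<in> {1..N} - {m} \<Longrightarrow> 0 < C j"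
    and lt: "\<And>n. n \<in> {1..N} \<Longrightarrow> light_tailed (F n)"
    and sep: "0 < separation N F \<sigma> m"
    and f: "\<And>t. 1 \<le> t \<Longrightarrow> 0 < f t" "mono_on {1..} f" "filterlim f at_top sequentially"
    and B: "B = (\<lambda>t. real N * real_of_int \<lceil>f t * ln (real t)\<rceil>)"
    and \<pi>: "dsee_policy M N B m (sample_mean X N B) \<pi>"
  shows "regret M N \<sigma> C m \<pi> \<in> O(\<lambda>T. f T * ln (real T))"
proof -
  define d where "d = separation N F \<sigma> m / 3"
  have d: "0 < d" "2 * d < separation N F \<sigma> m" using sep by (auto simp: d_def)
  define c where "c = Max (C ` ({1..N} - {m}))"
  have c: "0 < c" unfolding c_def by (rule Max_cost_pos[OF two_arms C])
  have in_range: "\<sigma> j \<in> {1..N}" if "j \<in> {1..N}" for j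
    by (rule ranks_arms_in_range[OF \<sigma> that])
  have ln0: "0 \<le> ln (real t)" for t by (cases "t = 0") auto
  have mono: "f s * ln (real s) \<le> f t * ln (real t)" if "1 \<le> s" "s \<le> t" for s t
    using that f(1)[of t] mono_onD[OF f(2), of s t] ln0 by (intro mult_mono) auto
  have nonneg: "0 \<le> f t * ln (real t)" for t
  proof (cases "t = 0")
    case False
    hence "0 < f t" using f(1) by simp
    with ln0[of t] show ?thesis by simp
  qed simp
  define P where "P n r \<longleftrightarrow> (\<forall>A. finite A \<longrightarrow> A \<subseteq> {1..} \<longrightarrow>
      prob {\<omega>\<in>space M. d < \<bar>(\<Sum>s\<in>A. X n s \<omega>) / real (card A) - arm_mean F n\<bar>} \<le> 2 * exp (- r * real (card A)))"
    for n r
  have "\<exists>r. 0 < r \<and> P n r" if "n \<in> {1..N}" for n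
    unfolding P_def by (rule light_tailed_deviation[OF that lt[OF that] d(1)])
  hence "\<exists>R. \<forall>n\<in>{1..N}. 0 < R n \<and> P n (R n)" by (intro bchoice ballI)
  then obtain R where R: "\<And>n. n \<in> {1..N} \<Longrightarrow> 0 < R n" "\<And>n. n \<in> {1..N} \<Longrightarrow> P n (R n)"
    by blast
  define r where "r = Min (R ` {1..N})"
  have r: "0 < r" unfolding r_def using R(1) two_arms by (subst Min_gr_iff) auto
  have r_le: "r \<le> R n" if "n \<in> {1..N}" for n unfolding r_def using that by (intro Min_le) auto
  define b where "b t = 2 * exp (- r * (f t * ln (real t)))" for t
  have bound: "regret M N \<sigma> C m \<pi> T \<le> (\<Sum>j\<in>{1..N} - {m}. real (card (obs_times N B (\<sigma> j) T)) * C j) +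
      c * (1 + real N * (\<Sum>t=2..T. b t))" if T: "1 \<le> T" for T
    unfolding c_def
  proof (rule regret_le[OF two_arms \<sigma> m C \<pi> d(2) sample_mean_measurable _ _ T])
    fix n t assume n: "n \<in> {1..N}" and t: "2 \<le> t" "t \<notin> explored B t"
    define k where "k = real (card (obs_times N B n (t - 1)))"
    have "f t * ln (real t) \<le> k"
      unfolding k_def
      by (rule order_trans[OF le_of_int_ceiling ceiling_le_card_obs_times[OF mono nonneg B n t]])
    hence k: "r * (f t * ln (real t)) \<le> R n * k"
      using r r_le[OF n] nonneg[of t] R(1)[OF n] by (intro mult_mono) (assumption | linarith)+
    have "prob {\<omega>\<in>space M. d < \<bar>sample_mean X N B n t \<omega> - arm_mean F n\<bar>} \<le> 2 * exp (- R n * k)"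
      unfolding sample_mean_def k_def by (rule R(2)[OF n, unfolded P_def, rule_format, OF finite_obs_times obs_times_subset])
    also have "\<dots> \<le> b t" using k by (simp add: b_def)
    finally show "prob {\<omega>\<in>space M. d < \<bar>sample_mean X N B n t \<omega> - arm_mean F n\<bar>} \<le> b t" .
  qed (auto simp: b_def)
  have "eventually (\<lambda>t. 2 / r \<le> f t) sequentially"
    using f(3) by (simp add: filterlim_at_top)
  then obtain t0 where t0: "\<And>t. t0 \<le> t \<Longrightarrow> 2 / r \<le> f t" by (auto simp: eventually_sequentially)
  \<comment> \<open>From \<open>t0\<close> on the terms are at most \<open>2 * t powr - 2\<close>,
    with total at most 2; before \<open>t0\<close> each is bounded trivially by 2.\<close>
  define K where "K = 2 + 2 * real t0"
  have sum_b: "(\<Sum>t=2..T. b t) \<le> K" for T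
  proof -
    have "(\<Sum>t=2..T. b t) \<le> (\<Sum>t=2..T. 2 * real t powr - 2 + (if t < t0 then 2 else 0))"
    proof (intro sum_mono)
      fix t assume t: "t \<in> {2..T}"
      show "b t \<le> 2 * real t powr - 2 + (if t < t0 then 2 else 0)"
      proof (cases "t < t0")
        case True
        have "b t \<le> 2" using r nonneg[of t] by (simp add: b_def)
        with True show ?thesis by (simp add: add_increasing)
      next
        case False
        hence "2 \<le> r * f t" using t0[of t] r by (simp add: field_simps)
        hence "2 * ln (real t) \<le> r * f t * ln (real t)" using ln0 by (rule mult_right_mono)
        hence "b t \<le> 2 * exp (- 2 * ln (real t))" by (simp add: b_def mult.assoc)
        also have "\<dots> = 2 * real t powr - 2" using t by (simp add: powr_def)
        finally show ?thesis using False by simp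
      qed
    qed
    also have "\<dots> = 2 * (\<Sum>t=2..T. real t powr - 2) + (\<Sum>t=2..T. if t < t0 then 2 else 0)"
      by (simp add: sum.distrib sum_distrib_left)
    also have "(\<Sum>t=2..T. if t < t0 then 2 else 0 :: real) \<le> (\<Sum>t\<in>{..<t0}. 2)"
    proof -
      have "(\<Sum>t=2..T. if t < t0 then 2 else 0 :: real) = (\<Sum>t\<in>{t \<in> {2..T}. t < t0}. 2)"
        by (rule sum.inter_filter[symmetric]) simp
      also have "\<dots> \<le> (\<Sum>t\<in>{..<t0}. 2)" by (rule sum_mono2) auto
      finally show ?thesis .
    qed
    also have "2 * (\<Sum>t=2..T. real t powr - 2) \<le> 2 * 1"
      using sum_powr_minus_le[of 2 T] by (intro mult_left_mono) auto
    finally show ?thesis by (simp add: K_def)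
  qed
  define Q where "Q = 2 * (\<Sum>j\<in>{1..N} - {m}. C j) + c * (1 + real N * K)"
  show ?thesis
  proof (rule bigoI[where c = Q])
    have "eventually (\<lambda>T. 1 \<le> f T) sequentially"
      using f(3) by (simp add: filterlim_at_top)
    moreover have "eventually (\<lambda>T. 3 \<le> T) sequentially" by (rule eventually_ge_at_top)
    ultimately show "eventually (\<lambda>T. norm (regret M N \<sigma> C m \<pi> T) \<le> Q * norm (f T * ln (real T))) sequentially"
    proof eventually_elim
      case (elim T)
      define g where "g = f T * ln (real T)"
      have T1: "1 \<le> T" using elim by simp
      \<comment> \<open>This is why \<open>T \<ge> 3\<close> is required: with \<open>ln T\<close>
        and \<open>f T\<close> at least 1, rounding and additive constants are absorbed into
        multiples of \<open>g\<close>.\<close>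
      have "exp 1 \<le> real T" using exp_le elim by linarith
      hence "1 \<le> ln (real T)" using elim by (subst ln_ge_iff) auto
      hence g: "1 \<le> g" using mult_mono[of 1 "f T" 1 "ln (real T)"] elim by (simp add: g_def)
      have "(\<Sum>j\<in>{1..N} - {m}. real (card (obs_times N B (\<sigma> j) T)) * C j) \<le> (\<Sum>j\<in>{1..N} - {m}. 2 * g * C j)"
      proof (intro sum_mono mult_right_mono)
        fix j assume j: "j \<in> {1..N} - {m}"
        show "0 \<le> C j" using C[OF j] by simp
        have "real (card (obs_times N B (\<sigma> j) T)) \<le> real_of_int \<lceil>g\<rceil>"
          unfolding g_def using j in_range by (intro card_obs_times_le_ceiling[OF mono nonneg B _ T1]) auto
        also have "\<dots> \<le> g + 1" by (rule of_int_ceiling_le_add_one)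
        finally show "real (card (obs_times N B (\<sigma> j) T)) \<le> 2 * g" using g by simp
      qed
      moreover have "c * (1 + real N * (\<Sum>t=2..T. b t)) \<le> c * (1 + real N * K) * g"
      proof -
        have "c * (1 + real N * (\<Sum>t=2..T. b t)) \<le> c * (1 + real N * K) * 1"
          using sum_b[of T] c by (simp add: mult_left_mono)
        also have "\<dots> \<le> c * (1 + real N * K) * g"
          using g c by (intro mult_left_mono mult_nonneg_nonneg) (auto simp: K_def)
        finally show ?thesis .
      qed
      ultimately have "regret M N \<sigma> C m \<pi> T \<le> Q * g"
        using bound[OF T1] by (simp add: Q_def algebra_simps sum_distrib_left)
      moreover have "0 \<le> regret M N \<sigma> C m \<pi> T" by (rule regret_nonneg) (rule C)
      ultimately show ?case using g by (simp add: g_def)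
    qed
  qed
qed

lemma (in stochastic_bandit) regret_finite_moment:
  assumes \<sigma>: "ranks_arms N (arm_mean F) \<sigma>" and m: "m \<in> {1..N}"
    and C: "\<And>j. j \<in> {1..N} - {m} \<Longrightarrow> 0 < C j"
    and p: "1 < p" and mom: "\<And>n. n \<in> {1..N} \<Longrightarrow> integrable (F n) (\<lambda>x. \<bar>x\<bar> powr p)"
    and v: "0 < v" and d: "0 < d" "d < separation N F \<sigma> m / 2"
    and q: "q = (if p \<le> 2 then 1 / p else 1 / (1 + p / 2))"
    and B: "B = (\<lambda>t. v * real t powr q)"
    and \<pi>: "dsee_policy M N B m (sample_mean X N B) \<pi>"
  shows "regret M N \<sigma> C m \<pi> \<in> O(\<lambda>T. real T powr q)"
proof -
  have d': "2 * d < separation N F \<sigma> m" using d by simp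
  define c where "c = Max (C ` ({1..N} - {m}))"
  have c: "0 < c" unfolding c_def by (rule Max_cost_pos[OF two_arms C])
  define \<beta> where "\<beta> = p - max 1 (p / 2)"
  have \<beta>: "0 < \<beta>" using p by (auto simp: \<beta>_def)
  have q_bounds: "0 < q" "q \<le> 1" using p by (auto simp: q)
  \<comment> \<open>The balance of exponents: \<open>q\<close> is the reciprocal of
    \<open>1 + \<beta>\<close> in both ranges of \<open>p\<close>.\<close>
  have q\<beta>: "- (q * \<beta>) = q - 1"
  proof -
    have "- (1 / y * (y - 1)) = 1 / y - 1" if "0 < y" for y :: real
      using that by (simp add: field_simps)
    from this[of p] this[of "1 + p / 2"] show ?thesis using p by (auto simp: q \<beta>_def)
  qed
  obtain K where K: "0 \<le> K" "\<And>n A. n \<in> {1..N} \<Longrightarrow> finite A \<Longrightarrow> A \<noteq> {} \<Longrightarrow> A \<subseteq> {1..} \<Longrightarrow>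
    prob {\<omega>\<in>space M. d < \<bar>(\<Sum>s\<in>A. X n s \<omega>) / real (card A) - arm_mean F n\<bar>} \<le> K * real (card A) powr - \<beta>"
    using finite_moment_deviation[OF p mom d(1)] unfolding \<beta>_def by auto
  define H where "H = (1 + K) * (v / (2 * real N)) powr - \<beta>"
  have H: "0 \<le> H" using K by (simp add: H_def)
  have bound: "regret M N \<sigma> C m \<pi> T \<le> (\<Sum>j\<in>{1..N} - {m}. real (card (obs_times N B (\<sigma> j) T)) * C j) +
      c * (1 + real N * (\<Sum>t=2..T. H * real t powr (q - 1)))" if T: "1 \<le> T" for T
    unfolding c_def
  proof (rule regret_le[OF two_arms \<sigma> m C \<pi> d' sample_mean_measurable _ _ T])
    fix n t assume n: "n \<in> {1..N}" and t: "2 \<le> t" "t \<notin> explored B t"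
    define A where "A = obs_times N B n (t - 1)"
    \<comment> \<open>Half of an arm's share of the budget. Once this exceeds 1, at least
      \<open>y\<close> observations remain after the rounding loss of one.\<close>
    define y where "y = v * real t powr q / (2 * real N)"
    have y: "0 < y" using v t two_arms by (simp add: y_def)
    have yH: "(1 + K) * y powr - \<beta> = H * real t powr (q - 1)"
    proof -
      have "y = v / (2 * real N) * real t powr q" by (simp add: y_def)
      hence "y powr - \<beta> = (v / (2 * real N)) powr - \<beta> * (real t powr q) powr - \<beta>"
        by (simp only: powr_mult)
      also have "(real t powr q) powr - \<beta> = real t powr (q - 1)"
        using q\<beta> by (simp add: powr_powr)
      finally show ?thesis by (simp add: H_def)
    qed
    show "prob {\<omega>\<in>space M. d < \<bar>sample_mean X N B n t \<omega> - arm_mean F n\<bar>} \<le> H * real t powr (q - 1)"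
    \<comment> \<open>For small \<open>y\<close> there may be no observation at all, but then the
      bound is at least 1; the constant \<open>1 + K\<close> instead of \<open>K\<close> ensures
      this.\<close>
    proof (cases "y \<le> 1")
      case True
      have "prob {\<omega>\<in>space M. d < \<bar>sample_mean X N B n t \<omega> - arm_mean F n\<bar>} \<le> 1 * 1" by simp
      also have "\<dots> \<le> (1 + K) * y powr - \<beta>"
        using True y \<beta> K powr_mono2'[of "- \<beta>" y 1] by (intro mult_mono) auto
      finally show ?thesis unfolding yH .
    next
      case False
      have "v * real t powr q \<le> real (card (explored B (t - 1)))"
        using budget_le_card_explored[OF t] by (simp add: B)
      from card_obs_times_ge_real[OF n this] have "2 * y - 1 \<le> real (card A)"
        by (simp add: y_def A_def)
      hence yA: "y \<le> real (card A)" using False by simp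
      hence "A \<noteq> {}" using y by auto
      have "prob {\<omega>\<in>space M. d < \<bar>sample_mean X N B n t \<omega> - arm_mean F n\<bar>} \<le> K * real (card A) powr - \<beta>"
        unfolding sample_mean_def A_def
        using \<open>A \<noteq> {}\<close> by (intro K(2)[OF n finite_obs_times _ obs_times_subset]) (simp add: A_def)
      also have "\<dots> \<le> (1 + K) * y powr - \<beta>"
        using yA y \<beta> K(1) by (intro mult_mono powr_mono2') auto
      finally show ?thesis unfolding yH .
    qed
  qed (use H in auto)
  have mono: "B s \<le> B t" if "1 \<le> s" "s \<le> t" for s t
    unfolding B using v that q_bounds by (intro mult_left_mono powr_mono2) auto
  have nonneg: "0 \<le> B t" for t using v by (simp add: B)
  define Q where "Q = (v + 1) * (\<Sum>j\<in>{1..N} - {m}. C j) + c * (1 + real N * (H / q))"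
  show ?thesis
  proof (rule bigoI[where c = Q])
    show "eventually (\<lambda>T. norm (regret M N \<sigma> C m \<pi> T) \<le> Q * norm (real T powr q)) sequentially"
      using eventually_ge_at_top[of 1]
    proof eventually_elim
      case (elim T)
      define g where "g = real T powr q"
      have g: "1 \<le> g" unfolding g_def using elim q_bounds by (intro ge_one_powr_ge_zero) auto
      have "(\<Sum>j\<in>{1..N} - {m}. real (card (obs_times N B (\<sigma> j) T)) * C j) \<le> (\<Sum>j\<in>{1..N} - {m}. (v + 1) * g * C j)"
      proof (intro sum_mono mult_right_mono)
        fix j assume j: "j \<in> {1..N} - {m}"
        show "0 \<le> C j" using C[OF j] by simp
        have "card (obs_times N B (\<sigma> j) T) \<le> card (explored B T)"
          unfolding obs_times_def by (intro card_mono) auto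
        hence "real (card (obs_times N B (\<sigma> j) T)) \<le> real (card (explored B T))" by simp
        also have "\<dots> \<le> v * g + 1"
          using card_explored_le_real[OF mono nonneg elim] by (simp add: B g_def)
        finally show "real (card (obs_times N B (\<sigma> j) T)) \<le> (v + 1) * g" using g by (simp add: distrib_right)
      qed
      moreover have "c * (1 + real N * (\<Sum>t=2..T. H * real t powr (q - 1))) \<le> c * ((1 + real N * (H / q)) * g)"
      proof (intro mult_left_mono)
        have "(\<Sum>t=2..T. real t powr (q - 1)) \<le> (\<Sum>t=1..T. real t powr (q - 1))"
          by (rule sum_mono2) auto
        also have "\<dots> \<le> g / q" unfolding g_def by (rule sum_powr_le[OF q_bounds])
        finally have "real N * (H * (\<Sum>t=2..T. real t powr (q - 1))) \<le> real N * (H * (g / q))"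
          using H by (intro mult_left_mono) auto
        thus "1 + real N * (\<Sum>t=2..T. H * real t powr (q - 1)) \<le> (1 + real N * (H / q)) * g"
          using g by (simp add: sum_distrib_left algebra_simps)
      qed (use c in auto)
      ultimately have "regret M N \<sigma> C m \<pi> T \<le> Q * g"
        using bound[OF elim] by (simp add: Q_def algebra_simps sum_distrib_left)
      moreover have "0 \<le> regret M N \<sigma> C m \<pi> T" by (rule regret_nonneg) (rule C)
      ultimately show ?case using g by (simp add: g_def)
    qed
  qed
qed

theorem theorem5:
  fixes M :: "'a measure" and N m :: nat and X :: "nat \<Rightarrow> nat \<Rightarrow> 'a \<Rightarrow> real"
    and F :: "nat \<Rightarrow> real measure" and \<sigma> :: "nat \<Rightarrow> nat" and C :: "nat \<Rightarrow> real"
  assumes bandit: "stochastic_bandit M N X F"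
    and best: "ranks_arms N (arm_mean F) \<sigma>"
    and m: "1 \<le> m" "m \<le> N"
    and cost_pos: "\<And>j. j \<in> {1..N} - {m} \<Longrightarrow> 0 < C j"
  shows
    "(\<forall>\<zeta> u0 a c \<delta> w :: real. \<forall>B \<pi>.
        (\<forall>n\<in>{1..N}. light_tailed (F n)) \<and>
        0 < \<zeta> \<and> 0 < u0 \<and> 0 < a \<and> a \<le> 1 / (2 * \<zeta>) \<and>
        (\<forall>n\<in>{1..N}. \<forall>s\<ge>1::nat. \<forall>\<delta>'. 0 \<le> \<delta>' \<and> \<delta>' \<le> \<zeta> * u0 \<longrightarrow>
           measure M {\<omega> \<in> space M. \<delta>' \<le> \<bar>(1 / real s) * (\<Sum>t=1..s. X n t \<omega>) - arm_mean F n\<bar>}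
             \<le> 2 * exp (- a * \<delta>'\<^sup>2 * real s)) \<and>
        0 < c \<and> c < separation N F \<sigma> m \<and> \<delta> = min (c / 2) (\<zeta> * u0) \<and> 1 / (a * \<delta>\<^sup>2) < w \<and>
        B = (\<lambda>t. real N * real_of_int \<lceil>w * ln (real t)\<rceil>) \<and>
        dsee_policy M N B m (sample_mean X N B) \<pi> \<longrightarrow>
        (\<forall>T\<ge>1.
           regret M N \<sigma> C m \<pi> T \<le>
             (\<Sum>j\<in>{1..N} - {m}. real_of_int \<lceil>w * ln (real T)\<rceil> * C j) +
             2 * real N * Max (C ` ({1..N} - {m})) * (1 + 1 / (a * \<delta>\<^sup>2 * w - 1)) \<and>
           ((\<Sum>j\<in>{1..N} - {m}. C j) \<le> (\<Sum>n=2..N. gap F \<sigma> n) \<and>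
            Max (C ` ({1..N} - {m})) \<le> gap F \<sigma> N \<longrightarrow>
            regret M N \<sigma> C m \<pi> T \<le>
             (\<Sum>n=2..N. real_of_int \<lceil>w * ln (real T)\<rceil> * gap F \<sigma> n) +
             2 * real N * gap F \<sigma> N * (1 + 1 / (a * \<delta>\<^sup>2 * w - 1)))))
     \<and>
     (\<forall>f :: nat \<Rightarrow> real. \<forall>B \<pi>.
        (\<forall>n\<in>{1..N}. light_tailed (F n)) \<and>
        0 < separation N F \<sigma> m \<and>
        (\<forall>t\<ge>1. 0 < f t) \<and> mono_on {1..} f \<and> filterlim f at_top sequentially \<and>
        B = (\<lambda>t. real N * real_of_int \<lceil>f t * ln (real t)\<rceil>) \<and>
        dsee_policy M N B m (sample_mean X N B) \<pi> \<longrightarrow>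
        regret M N \<sigma> C m \<pi> \<in> O(\<lambda>T. f T * ln (real T)))
     \<and>
     (\<forall>p v \<delta> :: real. \<forall>B \<pi>.
        1 < p \<and> (\<forall>n\<in>{1..N}. integrable (F n) (\<lambda>x. \<bar>x\<bar> powr p)) \<and>
        0 < v \<and> 0 < \<delta> \<and> \<delta> < separation N F \<sigma> m / 2 \<and>
        B = (\<lambda>t. v * real t powr (if p \<le> 2 then 1 / p else 1 / (1 + p / 2))) \<and>
        dsee_policy M N B m (sample_mean X N B) \<pi> \<longrightarrow>
        regret M N \<sigma> C m \<pi> \<in> O(\<lambda>T. real T powr (if p \<le> 2 then 1 / p else 1 / (1 + p / 2))))
     \<and>
     (\<forall>u p a \<delta> w :: real. \<forall>B \<pi>.
        0 < u \<and> 1 < p \<and> p \<le> 2 \<and>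
        (\<forall>n\<in>{1..N}. integrable (F n) (\<lambda>x. \<bar>x\<bar> powr p) \<and> (\<integral>x. \<bar>x\<bar> powr p \<partial>F n) \<le> u) \<and>
        a = 4 powr (p / (1 - p)) * u powr (1 / (1 - p)) \<and>
        0 < \<delta> \<and> \<delta> < separation N F \<sigma> m / 2 \<and> 1 / (a * \<delta> powr (p / (p - 1))) < w \<and>
        B = (\<lambda>t. real N * real_of_int \<lceil>w * ln (real t)\<rceil>) \<and>
        dsee_policy M N B m (truncated_mean u p a \<delta> X N B) \<pi> \<longrightarrow>
        (\<forall>T\<ge>1.
           regret M N \<sigma> C m \<pi> T \<le>
             (\<Sum>j\<in>{1..N} - {m}. real_of_int \<lceil>w * ln (real T)\<rceil> * C j) +
             2 * real N * Max (C ` ({1..N} - {m})) * (1 + 1 / (a * \<delta> powr (p / (p - 1)) * w - 1)) \<and>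
           ((\<Sum>j\<in>{1..N} - {m}. C j) \<le> (\<Sum>n=2..N. gap F \<sigma> n) \<and>
            Max (C ` ({1..N} - {m})) \<le> gap F \<sigma> N \<longrightarrow>
            regret M N \<sigma> C m \<pi> T \<le>
             (\<Sum>n=2..N. real_of_int \<lceil>w * ln (real T)\<rceil> * gap F \<sigma> n) +
             2 * real N * gap F \<sigma> N * (1 + 1 / (a * \<delta> powr (p / (p - 1)) * w - 1)))))"
proof -
  interpret stochastic_bandit M N X F by (rule bandit)
  have m': "m \<in> {1..N}" using m by simp
  show ?thesis
  proof (intro conjI; (intro allI impI; elim conjE)?)
    fix \<zeta> u0 a c \<delta> w :: real and B \<pi> and T :: nat
    assume pos: "0 < \<zeta>" "0 < u0" "0 < a" "0 < c"
      and tail: "\<forall>n\<in>{1..N}. \<forall>s\<ge>1::nat. \<forall>\<delta>'. 0 \<le> \<delta>' \<and> \<delta>' \<le> \<zeta> * u0 \<longrightarrow>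
           measure M {\<omega> \<in> space M. \<delta>' \<le> \<bar>(1 / real s) * (\<Sum>t=1..s. X n t \<omega>) - arm_mean F n\<bar>}
             \<le> 2 * exp (- a * \<delta>'\<^sup>2 * real s)"
      and c: "c < separation N F \<sigma> m" and \<delta>: "\<delta> = min (c / 2) (\<zeta> * u0)" and w: "1 / (a * \<delta>\<^sup>2) < w"
      and B: "B = (\<lambda>t. real N * real_of_int \<lceil>w * ln (real t)\<rceil>)"
      and \<pi>: "dsee_policy M N B m (sample_mean X N B) \<pi>" and T: "1 \<le> T"
    \<comment> \<open>The first term of the minimum keeps twice the deviation below the separation;
      the second keeps the deviation in the range of the tail hypothesis.\<close>
    have \<delta>_bounds: "0 < \<delta>" "\<delta> \<le> \<zeta> * u0" "2 * \<delta> < separation N F \<sigma> m"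
      using pos c by (auto simp: \<delta>)
    show "regret M N \<sigma> C m \<pi> T \<le>
             (\<Sum>j\<in>{1..N} - {m}. real_of_int \<lceil>w * ln (real T)\<rceil> * C j) +
             2 * real N * Max (C ` ({1..N} - {m})) * (1 + 1 / (a * \<delta>\<^sup>2 * w - 1)) \<and>
           ((\<Sum>j\<in>{1..N} - {m}. C j) \<le> (\<Sum>n=2..N. gap F \<sigma> n) \<and>
            Max (C ` ({1..N} - {m})) \<le> gap F \<sigma> N \<longrightarrow>
            regret M N \<sigma> C m \<pi> T \<le>
             (\<Sum>n=2..N. real_of_int \<lceil>w * ln (real T)\<rceil> * gap F \<sigma> n) +
             2 * real N * gap F \<sigma> N * (1 + 1 / (a * \<delta>\<^sup>2 * w - 1)))"
    proof (rule regret_le_logarithmic[OF two_arms best m' cost_pos B \<pi> \<delta>_bounds(3)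
          sample_mean_measurable _ _ w T])
      fix n t assume n: "n \<in> {1..N}" and card: "1 \<le> card (obs_times N B n (t - 1))"
      define A where "A = obs_times N B n (t - 1)"
      have A: "finite A" "A \<noteq> {}" "A \<subseteq> {1..}" "1 \<le> card A"
        using card obs_times_subset by (auto simp: A_def)
      have meas: "sample_mean X N B n t \<in> borel_measurable M" by (rule sample_mean_measurable[OF n])
      have "prob {\<omega>\<in>space M. \<delta> < \<bar>sample_mean X N B n t \<omega> - arm_mean F n\<bar>}
          \<le> prob {\<omega>\<in>space M. \<delta> \<le> \<bar>sample_mean X N B n t \<omega> - arm_mean F n\<bar>}"
        using meas by (intro finite_measure_mono) auto
      also have "\<dots> = prob {\<omega>\<in>space M. \<delta> \<le> \<bar>(\<Sum>s=1..card A. X n s \<omega>) / real (card A) - arm_mean F n\<bar>}"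
        unfolding sample_mean_def A_def[symmetric] by (rule deviation_prob_times_irrelevant[OF n A(1-3)])
      also have "\<dots> \<le> 2 * exp (- a * \<delta>\<^sup>2 * real (card A))"
        using tail n A(4) \<delta>_bounds by simp
      finally show "prob {\<omega>\<in>space M. \<delta> < \<bar>sample_mean X N B n t \<omega> - arm_mean F n\<bar>}
          \<le> 2 * exp (- (a * \<delta>\<^sup>2) * real (card (obs_times N B n (t - 1))))" by (simp add: A_def)
    qed (use pos \<delta>_bounds in auto)
  next
    fix f :: "nat \<Rightarrow> real" and B \<pi>
    assume "\<forall>n\<in>{1..N}. light_tailed (F n)" "0 < separation N F \<sigma> m" "\<forall>t\<ge>1. 0 < f t"
      "mono_on {1..} f" "filterlim f at_top sequentially"
      "B = (\<lambda>t. real N * real_of_int \<lceil>f t * ln (real t)\<rceil>)"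
      "dsee_policy M N B m (sample_mean X N B) \<pi>"
    thus "regret M N \<sigma> C m \<pi> \<in> O(\<lambda>T. f T * ln (real T))"
      by (intro regret_light_tailed[OF best m' cost_pos]) auto
  next
    fix p v \<delta> :: real and B \<pi>
    assume "1 < p" "\<forall>n\<in>{1..N}. integrable (F n) (\<lambda>x. \<bar>x\<bar> powr p)" "0 < v" "0 < \<delta>"
      "\<delta> < separation N F \<sigma> m / 2"
      "B = (\<lambda>t. v * real t powr (if p \<le> 2 then 1 / p else 1 / (1 + p / 2)))"
      "dsee_policy M N B m (sample_mean X N B) \<pi>"
    thus "regret M N \<sigma> C m \<pi> \<in> O(\<lambda>T. real T powr (if p \<le> 2 then 1 / p else 1 / (1 + p / 2)))"
      by (intro regret_finite_moment[OF best m' cost_pos _ _ _ _ _ refl]) auto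
  next
    fix u p a \<delta> w :: real and B \<pi> and T :: nat
    assume u: "0 < u" and p: "1 < p" "p \<le> 2"
      and mom: "\<forall>n\<in>{1..N}. integrable (F n) (\<lambda>x. \<bar>x\<bar> powr p) \<and> (\<integral>x. \<bar>x\<bar> powr p \<partial>F n) \<le> u"
      and a: "a = 4 powr (p / (1 - p)) * u powr (1 / (1 - p))"
      and \<delta>: "0 < \<delta>" "\<delta> < separation N F \<sigma> m / 2" and w: "1 / (a * \<delta> powr (p / (p - 1))) < w"
      and B: "B = (\<lambda>t. real N * real_of_int \<lceil>w * ln (real t)\<rceil>)"
      and \<pi>: "dsee_policy M N B m (truncated_mean u p a \<delta> X N B) \<pi>" and T: "1 \<le> T"
    have \<delta>2: "2 * \<delta> < separation N F \<sigma> m" using \<delta> by simp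
    show "regret M N \<sigma> C m \<pi> T \<le>
             (\<Sum>j\<in>{1..N} - {m}. real_of_int \<lceil>w * ln (real T)\<rceil> * C j) +
             2 * real N * Max (C ` ({1..N} - {m})) * (1 + 1 / (a * \<delta> powr (p / (p - 1)) * w - 1)) \<and>
           ((\<Sum>j\<in>{1..N} - {m}. C j) \<le> (\<Sum>n=2..N. gap F \<sigma> n) \<and>
            Max (C ` ({1..N} - {m})) \<le> gap F \<sigma> N \<longrightarrow>
            regret M N \<sigma> C m \<pi> T \<le>
             (\<Sum>n=2..N. real_of_int \<lceil>w * ln (real T)\<rceil> * gap F \<sigma> n) +
             2 * real N * gap F \<sigma> N * (1 + 1 / (a * \<delta> powr (p / (p - 1)) * w - 1)))"
    proof (rule regret_le_logarithmic[OF two_arms best m' cost_pos B \<pi> \<delta>2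
          truncated_mean_measurable _ _ w T])
      fix n t assume n: "n \<in> {1..N}" and card: "1 \<le> card (obs_times N B n (t - 1))"
      show "prob {\<omega>\<in>space M. \<delta> < \<bar>truncated_mean u p a \<delta> X N B n t \<omega> - arm_mean F n\<bar>}
          \<le> 2 * exp (- (a * \<delta> powr (p / (p - 1))) * real (card (obs_times N B n (t - 1))))"
        using mom n by (intro truncated_mean_deviation[OF n p u _ _ a \<delta>(1) card]) auto
    qed (use u \<delta> in \<open>auto simp: a\<close>)
  qed
qed

end
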